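(* Assume $1 \leq p < \infty$ and that $\psi \in L^p(\mathbb{R}^d)$ is nonnegative. When $p=1$ assume $\int_{\mathbb{R}^d} \psi \, dx = 1$, and when $1<p<\infty$ assume $P\psi \equiv 1$ (which implies $\int_{\mathbb{R}^d} \psi \, dx = 1$). Let $\frac1p+\frac1q=1$. Then for all $f \in L^p$, $$\| f \|_p = |\det b|^{-1/q} \inf \left\{ \| c \|_{\ell^1(\ell^p)} : c\in\ell^1(\ell^p),\ f=Sc \right\},$$ where $f=Sc$ is understood with the series $Sc=\sum_{j>0}\sum_{k\in\mathbb{Z}^d} c_{j,k}\psi_{j,k}$ converging in the sense that the sum over $k$ converges pointwise absolutely a.e. to a function in $L^p$ and the sum over $j$ converges absolutely in $L^p$.
   Context: Fix $d \in \mathbb{N}$. The dilation matrices $a_j$ ($j=1,2,3,\ldots$) are invertible $d \times d$ real matrices that are expanding: $\|a_j^{-1}\| \to 0$ as $j \to \infty$ (operator norm on $\mathbb{R}^d$). The translation matrix $b$ is an invertible $d \times d$ real matrix. $L^p=L^p(\mathbb{R}^d)$ consists of complex-valued functions. Sums over $j>0$ are over $j=1,2,3,\ldots$; $1/\infty=0$. For $\psi \in L^p$ put $\psi_{j,k}(x) = |\det a_j|^{1/p}\psi(a_j x - bk)$, $x \in \mathbb{R}^d$, $k \in \mathbb{Z}^d$. The synthesis operator is $Sc=\sum_{j>0}\sum_{k\in\mathbb{Z}^d}c_{j,k}\psi_{j,k}$. For sequences $c=\{c_{j,k}\}_{j>0,k\in\mathbb{Z}^d}$ of complex numbers, $\|c\|_{\ell^1(\ell^p)}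 = \sum_{j>0} \big(\sum_{k\in\mathbb{Z}^d}|c_{j,k}|^p\big)^{1/p}$, and $\ell^1(\ell^p)$ is the Banach space of sequences with finite norm. The periodization of a function $f$ is $Pf(x) = |\det b|\sum_{k\in\mathbb{Z}^d} f(x-bk)$; identities between periodizations are understood almost everywhere. *)

theory Defs
  imports "HOL-Analysis.Analysis"
begin

text \<open>
  Elements of \<open>L\<^sup>p\<close> are represented by Lebesgue measurable functions, not by equivalence classes;
  equality in \<open>L\<^sup>p\<close> is therefore expressed by almost-everywhere statements or by vanishing
  of the norm of a difference.
\<close>

definition Lp_space :: "real \<Rightarrow> (real ^ 'n \<Rightarrow> complex) set" where
  "Lp_space p = {f \<in> borel_measurable lebesgue. integrable lebesgue (\<lambda>x. norm (f x) powr p)}"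

definition Lp_norm :: "real \<Rightarrow> (real ^ 'n \<Rightarrow> complex) \<Rightarrow> real" where
  "Lp_norm p f = (LINT x|lebesgue. norm (f x) powr p) powr (1 / p)"

definition expanding :: "(nat \<Rightarrow> real ^ 'n ^ 'n) \<Rightarrow> bool" where
  "expanding a \<longleftrightarrow> (\<lambda>j. onorm ((*v) (matrix_inv (a j)))) \<longlonglongrightarrow> 0"

definition lattice_vec :: "int ^ 'n \<Rightarrow> real ^ 'n" where
  "lattice_vec k = (\<chi> i. of_int (k $ i))"

definition periodization ::
    "real ^ 'n ^ 'n \<Rightarrow> (real ^ 'n \<Rightarrow> complex) \<Rightarrow> real ^ 'n \<Rightarrow> complex" where
  "periodization b f x =
     of_real \<bar>det b\<bar> * (\<Sum>\<^sub>\<infinity>k::int ^ 'n. f (x - b *v lattice_vec k))"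

definition affine_system ::
    "real \<Rightarrow> (nat \<Rightarrow> real ^ 'n ^ 'n) \<Rightarrow> real ^ 'n ^ 'n \<Rightarrow> (real ^ 'n \<Rightarrow> complex)
      \<Rightarrow> nat \<Rightarrow> int ^ 'n \<Rightarrow> real ^ 'n \<Rightarrow> complex" where
  "affine_system p a b \<psi> j k x =
     of_real (\<bar>det (a j)\<bar> powr (1 / p)) * \<psi> (a j *v x - b *v lattice_vec k)"

text \<open>
  The dilation index ranges over \<open>j > 0\<close>. Matrices and coefficients at \<open>j = 0\<close> exist in the
  types below but are never used.
\<close>

definition l1lp_space :: "real \<Rightarrow> (nat \<Rightarrow> int ^ 'n \<Rightarrow> complex) set" where
  "l1lp_space p = {c. (\<forall>j>0. (\<lambda>k. norm (c j k) powr p) summable_on UNIV) \<and>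
     (\<lambda>j. (\<Sum>\<^sub>\<infinity>k. norm (c j k) powr p) powr (1 / p)) summable_on {0<..}}"

definition l1lp_norm :: "real \<Rightarrow> (nat \<Rightarrow> int ^ 'n \<Rightarrow> complex) \<Rightarrow> real" where
  "l1lp_norm p c = (\<Sum>\<^sub>\<infinity>j\<in>{0<..}. (\<Sum>\<^sub>\<infinity>k. norm (c j k) powr p) powr (1 / p))"

definition synthesis_level ::
    "real \<Rightarrow> (nat \<Rightarrow> real ^ 'n ^ 'n) \<Rightarrow> real ^ 'n ^ 'n \<Rightarrow> (real ^ 'n \<Rightarrow> complex)
      \<Rightarrow> (nat \<Rightarrow> int ^ 'n \<Rightarrow> complex) \<Rightarrow> nat \<Rightarrow> real ^ 'n \<Rightarrow> complex" where
  "synthesis_level p a b \<psi> c j x = (\<Sum>\<^sub>\<infinity>k. c j k * affine_system p a b \<psi> j k x)"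

text \<open>
  \<open>f = Sc\<close>: at each level the sum over \<open>k\<close> converges absolutely almost everywhere to a function
  in \<open>L\<^sup>p\<close>, the \<open>L\<^sup>p\<close> norms of these functions are summable over \<open>j\<close>, and the partial sums over
  \<open>j\<close> converge to \<open>f\<close> in \<open>L\<^sup>p\<close>.
\<close>

definition is_synthesis ::
    "real \<Rightarrow> (nat \<Rightarrow> real ^ 'n ^ 'n) \<Rightarrow> real ^ 'n ^ 'n \<Rightarrow> (real ^ 'n \<Rightarrow> complex)
      \<Rightarrow> (nat \<Rightarrow> int ^ 'n \<Rightarrow> complex) \<Rightarrow> (real ^ 'n \<Rightarrow> complex) \<Rightarrow> bool" where
  "is_synthesis p a b \<psi> c f \<longleftrightarrow>
     (\<forall>j>0. (AE x in lebesgue.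
               (\<lambda>k. norm (c j k * affine_system p a b \<psi> j k x)) summable_on UNIV) \<and>
            synthesis_level p a b \<psi> c j \<in> Lp_space p) \<and>
     (\<lambda>j. Lp_norm p (synthesis_level p a b \<psi> c j)) summable_on {0<..} \<and>
     f \<in> Lp_space p \<and>
     (\<lambda>N. Lp_norm p (\<lambda>x. f x - (\<Sum>j\<in>{0<..N}. synthesis_level p a b \<psi> c j x))) \<longlonglongrightarrow> 0"

end

theory Submission
  imports Defs
begin

text \<open>
  Write \<open>L = |det b|\<close> and \<open>w = \<psi>\<close>. Since \<open>L \<Sum>\<^sub>k w(x - bk) \<le> 1\<close> when \<open>p > 1\<close>, convexity of \<open>t\<^sup>p\<close> gives
  \<open>|L \<Sum>\<^sub>k c\<^sub>k w(ax - bk)|\<^sup>p \<le> L \<Sum>\<^sub>k |c\<^sub>k|\<^sup>p w(ax - bk)\<close> (trivially so when \<open>p = 1\<close>). Integrating, each level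
  of \<open>Sc\<close> has norm at most \<open>L\<^bsup>-1/q\<^esup> \<parallel>c\<^sub>j\<parallel>\<close> in \<open>\<ell>\<^sup>p\<close>, and the triangle inequality gives one half of
  the theorem.

  For the other half, sample a continuous compactly supported \<open>u\<close> at the points \<open>a\<^sub>j\<^sup>-\<^sup>1bk\<close>, with coefficients
  proportional to \<open>\<delta> u(a\<^sub>j\<^sup>-\<^sup>1bk)\<close>. For large \<open>j\<close> the resulting level is close to \<open>\<delta> u(x) h(a\<^sub>j x)\<close>, where
  \<open>h\<close> is the periodization of \<open>w\<close>. If \<open>p > 1\<close> then \<open>h = 1\<close> and \<open>\<delta> = 1\<close> works. If \<open>p = 1\<close> the function
  \<open>h\<close> may be unbounded, so \<open>w\<close> is first truncated to make \<open>\<delta>h \<le> 1\<close> for some small \<open>\<delta>\<close>; then \<open>1 - \<delta>h \<ge> 0\<close>,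
  and as the mean of \<open>h\<close> is nearly \<open>1\<close> the norm of the remainder drops to about \<open>(1 - \<delta>) \<parallel>u\<parallel>\<close> at a
  cost of about \<open>\<delta> \<parallel>u\<parallel>\<close>. In both cases the cost is at most \<open>\<kappa>\<close> times the decrease of the norm,
  with \<open>\<kappa>\<close> as close to \<open>1\<close> as desired. Repeating this on the remainders, the costs telescope to at most
  \<open>\<kappa> \<parallel>f\<parallel>\<close> while the remainders tend to \<open>0\<close> geometrically.
\<close>

section \<open>Affine changes of variables\<close>

lemma matrix_inv_mult:
  assumes "invertible A"
  shows "A ** matrix_inv A = mat 1" "matrix_inv A ** A = mat 1"
  using someI_ex[OF assms[unfolded invertible_def]] by (auto simp: matrix_inv_def)

text \<open>The library's \<open>measure_linear_image\<close> needs a well-ordered index type.\<close>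

lemma measure_linear_image_det:
  fixes f :: "real ^ 'n \<Rightarrow> real ^ 'n"
  assumes "linear f"
  shows "\<forall>S\<in>lmeasurable. f ` S \<in> lmeasurable \<and>
    measure lebesgue (f ` S) = \<bar>det (matrix f)\<bar> * measure lebesgue S"
    (is "?P f")
proof (rule induct_linear_elementary [OF assms])
  fix f g :: "real ^ 'n \<Rightarrow> real ^ 'n"
  assume fg: "linear f" "linear g" "?P f" "?P g"
  show "?P (f \<circ> g)"
    unfolding image_comp[symmetric] matrix_compose[OF fg(2,1)]
    using fg(3,4) by (simp add: det_mul abs_mult)
next
  fix f :: "real ^ 'n \<Rightarrow> real ^ 'n" and i
  assume f: "linear f" "\<And>x. f x $ i = 0"
  have "\<not> surj f"
  proof
    assume "surj f"
    then obtain x where "f x = axis i 1" by (metis surjE)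
    with f(2)[of x] show False by simp
  qed
  then have ni: "\<not> inj f"
    using f(1) linear_injective_imp_surjective by blast
  then have "negligible (f ` S)" for S
    using f(1) negligible_linear_singular_image by blast
  moreover have "det (matrix f) = 0"
    using ni det_nz_iff_inj[OF f(1)] by blast
  ultimately show "?P f"
    by (auto simp: negligible_iff_measure)
next
  fix c
  show "?P (\<lambda>x. \<chi> i. c i * x $ i)"
    by (auto simp: measurable_stretch measure_stretch axis_def matrix_def det_diagonal)
next
  fix m n :: 'n
  assume "m \<noteq> n"
  let ?t = "Transposition.transpose m n"
  let ?h = "\<lambda>x::real ^ 'n. \<chi> i. x $ ?t i"
  have lin: "linear ?h"
    by (rule linearI) (simp_all add: vec_eq_iff)
  \<comment> \<open>The swap of two coordinates carries a box to the box with swapped corners, so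
    the volumes are products of the same side lengths.\<close>
  have im: "?h ` cbox a b = cbox (?h a) (?h b)" for a b
  proof (intro equalityI subsetI)
    fix y assume "y \<in> cbox (?h a) (?h b)"
    then have "a $ i \<le> ?h y $ i \<and> ?h y $ i \<le> b $ i" for i
      by (simp add: mem_box_cart) (metis transpose_involutory)
    then have "?h y \<in> cbox a b"
      by (auto simp: mem_box_cart)
    moreover have "?h (?h y) = y"
      by (simp add: vec_eq_iff)
    ultimately show "y \<in> ?h ` cbox a b"
      by (metis imageI)
  qed (auto simp: mem_box_cart)
  have meq: "measure lebesgue (?h ` cbox a b) = 1 * measure lebesgue (cbox a b)" for a b
  proof (cases "cbox a b = {}")
    case False
    then have "cbox (?h a) (?h b) \<noteq> {}"
      using im[of a b] by auto
    moreover have "(\<Prod>i\<in>UNIV. b $ ?t i - a $ ?t i) = (\<Prod>i\<in>UNIV. b $ i - a $ i)"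
      using prod.permute [OF permutes_swap_id, where S=UNIV and g="\<lambda>i. b $ i - a $ i"]
      by (simp add: o_def)
    ultimately show ?thesis
      using False by (simp add: im content_cbox_cart)
  qed auto
  have "matrix ?h = (\<chi> i. mat 1 $ ?t i)"
    by (simp add: matrix_def axis_def mat_def vec_eq_iff)
  then have "\<bar>det (matrix ?h)\<bar> = 1"
    by (simp add: det_permute_rows permutes_swap_id sign_swap_id abs_mult)
  then have "measure lebesgue (?h ` S) = \<bar>det (matrix ?h)\<bar> * measure lebesgue S"
    if "S \<in> lmeasurable" for S
    using conjunct2[OF measure_linear_sufficient [OF lin that meq]] by (simp only: abs_one mult_1)
  then show "?P ?h"
    using conjunct1[OF measure_linear_sufficient [OF lin _ meq]] by blast
next
  fix m n :: 'n
  assume mn: "m \<noteq> n"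
  let ?h = "\<lambda>x::real ^ 'n. \<chi> i. if i = m then x $ m + x $ n else x $ i"
  have lin: "linear ?h"
    by (rule linearI) (auto simp: algebra_simps vec_eq_iff)
  have meq: "measure lebesgue (?h ` cbox a b) = 1 * measure lebesgue (cbox a b)" for a b
  proof (cases "cbox a b = {}")
    case False
    \<comment> \<open>The shear formula for boxes asks for a lower corner that is nonnegative in the
      coordinate \<open>n\<close>. Translating the corner \<open>a\<close> to the origin provides
      this without changing volumes.\<close>
    have box: "(+) (- a) ` cbox a b = cbox 0 (b - a)"
      using cbox_translation[of "- a" a b] by (simp del: add_uminus_conv_diff)
    have "?h ` (+) (- a) ` cbox a b = (+) (?h (- a)) ` ?h ` cbox a b"
      unfolding image_image using linear_add[OF lin] by auto
    then have "measure lebesgue (?h ` cbox a b) = measure lebesgue (?h ` (+) (- a) ` cbox a b)"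
      by (simp add: measure_translation)
    also have "\<dots> = measure lebesgue (?h ` cbox 0 (b - a))"
      by (simp only: box)
    also have "\<dots> = measure lebesgue (cbox 0 (b - a))"
      by (rule measure_shear_interval)
        (use False mn in \<open>auto simp: interval_ne_empty_cart\<close>)
    also have "\<dots> = measure lebesgue ((+) (- a) ` cbox a b)"
      by (simp only: box)
    also have "\<dots> = measure lebesgue (cbox a b)"
      by (rule measure_translation)
    finally show ?thesis by simp
  qed auto
  have "matrix ?h = (\<chi> k. if k = m then row m (mat 1) + 1 *s row n (mat 1) else row k (mat 1))"
    by (auto simp: matrix_def axis_def mat_def vec_eq_iff row_def)
  then have "det (matrix ?h) = 1"
    using det_row_operation[OF mn, of "mat 1 :: real ^ 'n ^ 'n" 1] by simp
  then have "measure lebesgue (?h ` S) = \<bar>det (matrix ?h)\<bar> * measure lebesgue S"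
    if "S \<in> lmeasurable" for S
    using conjunct2[OF measure_linear_sufficient [OF lin that meq]] by (simp only: abs_one mult_1)
  then show "?P ?h"
    using conjunct1[OF measure_linear_sufficient [OF lin _ meq]] by blast
qed

text \<open>Continuity alone controls only preimages of Borel sets. Here the preimage of a Lebesgue
  set is its image under the inverse affine map, and differentiable maps of the space into itself
  preserve Lebesgue measurability.\<close>

lemma affine_measurable_lebesgue:
  fixes M :: "real ^ 'n ^ 'n"
  assumes "invertible M"
  shows "(\<lambda>x. M *v x + t) \<in> lebesgue \<rightarrow>\<^sub>M lebesgue"
proof (rule measurableI)
  fix S :: "(real ^ 'n) set"
  assume S: "S \<in> sets lebesgue"
  let ?g = "\<lambda>y. matrix_inv M *v (y - t)"
  have inv: "matrix_inv M ** M = mat 1" "M ** matrix_inv M = mat 1"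
    by (rule matrix_inv_mult[OF assms])+
  have "(\<lambda>x. M *v x + t) -` S = ?g ` S"
  proof (intro equalityI subsetI)
    fix x assume "x \<in> (\<lambda>x. M *v x + t) -` S"
    moreover have "x = ?g (M *v x + t)"
      by (simp add: matrix_vector_mul_assoc inv)
    ultimately show "x \<in> ?g ` S" by blast
  next
    fix x assume "x \<in> ?g ` S"
    then show "x \<in> (\<lambda>x. M *v x + t) -` S"
      by (auto simp: matrix_vector_mul_assoc inv)
  qed
  moreover have "?g differentiable_on S"
    unfolding matrix_vector_mult_diff_distrib
    by (intro differentiable_on_diff differentiable_on_const linear_imp_differentiable_on) simp
  ultimately show "(\<lambda>x. M *v x + t) -` S \<inter> space lebesgue \<in> sets lebesgue"
    using differentiable_image_in_sets_lebesgue[OF S, of ?g] by simp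
qed simp

text \<open>The image formula for linear maps, applied to the preimage of \<open>S\<close>, gives
  the factor \<open>1 / \<bar>det M\<bar>\<close>. That formula speaks only of sets of finite
  measure. If the preimage has infinite measure then so has \<open>S\<close>, since otherwise the
  inverse map would carry \<open>S\<close> to a set of finite measure.\<close>

lemma distr_affine_lebesgue:
  fixes M :: "real ^ 'n ^ 'n"
  assumes "invertible M"
  shows "distr lebesgue lebesgue (\<lambda>x. M *v x + t) =
    scale_measure (ennreal (1 / \<bar>det M\<bar>)) lebesgue"
proof (rule measure_eqI)
  let ?T = "\<lambda>x. M *v x + t"
  have det: "det M \<noteq> 0"
    using assms by (simp add: invertible_det_nz)
  have mT: "?T \<in> lebesgue \<rightarrow>\<^sub>M lebesgue"
    by (rule affine_measurable_lebesgue[OF assms])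
  have inv: "matrix_inv M ** M = mat 1" "M ** matrix_inv M = mat 1"
    by (rule matrix_inv_mult[OF assms])+
  have surj: "?T ` (?T -` S) = S" for S
  proof -
    have "y = ?T (matrix_inv M *v (y - t))" for y
      by (simp add: matrix_vector_mul_assoc inv)
    then have "surj ?T" by (rule surjI[OF sym])
    then show ?thesis by (rule surj_image_vimage_eq)
  qed
  fix S :: "(real ^ 'n) set"
  assume "S \<in> sets (distr lebesgue lebesgue ?T)"
  then have S: "S \<in> sets lebesgue" by simp
  let ?V = "?T -` S"
  have V: "?V \<in> sets lebesgue"
    using measurable_sets[OF mT S] by simp
  have img: "?T ` U = (+) t ` (*v) M ` U" for U
    by (auto simp: image_image add.commute)
  have lin: "(*v) M ` U \<in> lmeasurable"
      "measure lebesgue ((*v) M ` U) = \<bar>det M\<bar> * measure lebesgue U" if "U \<in> lmeasurable" for U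
    using measure_linear_image_det[of "(*v) M"] that by auto
  have fin: "S \<in> lmeasurable \<and> measure lebesgue S = \<bar>det M\<bar> * measure lebesgue ?V"
    if "?V \<in> lmeasurable"
  proof -
    have "S = (+) t ` (*v) M ` ?V"
      using surj[of S] img[of ?V] by simp
    then show ?thesis
      using lin[OF that] measurable_translation[of "(*v) M ` ?V" t]
        measure_translation[of t "(*v) M ` ?V"] by simp
  qed
  have "emeasure lebesgue ?V = ennreal (1 / \<bar>det M\<bar>) * emeasure lebesgue S"
  proof (cases "?V \<in> lmeasurable")
    case True
    then show ?thesis
      using fin[OF True] det
      by (simp add: emeasure_eq_measure2 ennreal_mult'[symmetric])
  next
    case False
    have "S \<notin> lmeasurable"
    proof
      assume "S \<in> lmeasurable"
      then have "(+) (- t) ` S \<in> lmeasurable"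
        by (rule measurable_translation)
      then have "(*v) (matrix_inv M) ` (+) (- t) ` S \<in> lmeasurable"
        using measure_linear_image_det[of "(*v) (matrix_inv M)"] by blast
      moreover have "(*v) (matrix_inv M) ` (+) (- t) ` S = ?V"
      proof (intro equalityI subsetI)
        fix x assume "x \<in> ?V"
        moreover have "x = matrix_inv M *v (- t + ?T x)"
          by (simp add: matrix_vector_mul_assoc inv)
        ultimately show "x \<in> (*v) (matrix_inv M) ` (+) (- t) ` S" by blast
      qed (auto simp: matrix_vector_mul_assoc inv)
      ultimately show False using False by simp
    qed
    then have "emeasure lebesgue S = \<infinity>" "emeasure lebesgue ?V = \<infinity>"
      using S V False by (auto simp: fmeasurable_def less_top[symmetric])
    then show ?thesis
      using det by (simp add: ennreal_mult_top)
  qed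
  then show "emeasure (distr lebesgue lebesgue ?T) S =
      emeasure (scale_measure (ennreal (1 / \<bar>det M\<bar>)) lebesgue) S"
    using S mT by (simp add: emeasure_distr)
qed simp

lemma nn_integral_affine:
  fixes M :: "real ^ 'n ^ 'n"
  assumes "invertible M" "F \<in> borel_measurable lebesgue"
  shows "(\<integral>\<^sup>+x. F (M *v x + t) \<partial>lebesgue) = ennreal (1 / \<bar>det M\<bar>) * (\<integral>\<^sup>+x. F x \<partial>lebesgue)"
proof -
  have "(\<integral>\<^sup>+x. F (M *v x + t) \<partial>lebesgue) = (\<integral>\<^sup>+x. F x \<partial>distr lebesgue lebesgue (\<lambda>x. M *v x + t))"
    by (rule nn_integral_distr[symmetric]) (use assms affine_measurable_lebesgue in auto)
  also have "\<dots> = ennreal (1 / \<bar>det M\<bar>) * (\<integral>\<^sup>+x. F x \<partial>lebesgue)"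
    by (simp add: distr_affine_lebesgue[OF assms(1)] nn_integral_scale_measure assms(2))
  finally show ?thesis .
qed

lemma borel_measurable_affine:
  fixes M :: "real ^ 'n ^ 'n"
  assumes "invertible M" "F \<in> borel_measurable lebesgue"
  shows "(\<lambda>x. F (M *v x + t)) \<in> borel_measurable lebesgue"
  using measurable_compose[OF affine_measurable_lebesgue[OF assms(1)] assms(2)] .

lemma integral_affine:
  fixes M :: "real ^ 'n ^ 'n" and F :: "real ^ 'n \<Rightarrow> real"
  assumes M: "invertible M" and F: "integrable lebesgue F" "\<And>x. 0 \<le> F x"
  shows "integrable lebesgue (\<lambda>x. F (M *v x + t))"
    and "(LINT x|lebesgue. F (M *v x + t)) = (LINT x|lebesgue. F x) / \<bar>det M\<bar>"
proof -
  have Fm: "F \<in> borel_measurable lebesgue"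
    using F(1) by simp
  have "(\<integral>\<^sup>+x. ennreal (F (M *v x + t)) \<partial>lebesgue) =
      ennreal (1 / \<bar>det M\<bar>) * (\<integral>\<^sup>+x. ennreal (F x) \<partial>lebesgue)"
    using nn_integral_affine[OF M, of "\<lambda>x. ennreal (F x)"] Fm by simp
  also have "\<dots> = ennreal ((LINT x|lebesgue. F x) / \<bar>det M\<bar>)"
    using F by (subst nn_integral_eq_integral) (auto simp: ennreal_mult'[symmetric])
  finally have eq: "(\<integral>\<^sup>+x. ennreal (F (M *v x + t)) \<partial>lebesgue) =
      ennreal ((LINT x|lebesgue. F x) / \<bar>det M\<bar>)" .
  have m: "(\<lambda>x. F (M *v x + t)) \<in> borel_measurable lebesgue"
    by (rule borel_measurable_affine[OF M Fm])
  show "integrable lebesgue (\<lambda>x. F (M *v x + t))"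
    by (rule integrableI_nonneg[OF m]) (use F(2) eq in auto)
  show "(LINT x|lebesgue. F (M *v x + t)) = (LINT x|lebesgue. F x) / \<bar>det M\<bar>"
    using F(2) eq by (intro integral_eq_nn_integral[OF m, THEN trans]) (auto intro!: integral_nonneg)
qed

text \<open>The identity between \<open>\<psi>\<close> and \<open>w\<close> and the bound on the
  periodization hold only almost everywhere. This transports them to the arguments
  \<open>A *v x - b *v lattice_vec k\<close>.\<close>

lemma AE_affine:
  fixes M :: "real ^ 'n ^ 'n"
  assumes M: "invertible M" and P: "AE x in lebesgue. P x"
  shows "AE x in lebesgue. P (M *v x + t)"
proof -
  obtain N where N: "\<And>x. x \<in> space lebesgue - N \<Longrightarrow> P x" "N \<in> null_sets lebesgue"
    by (rule AE_E3[OF P]) blast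
  let ?T = "\<lambda>x. M *v x + t"
  have "emeasure (distr lebesgue lebesgue ?T) N = 0"
    using N by (simp add: distr_affine_lebesgue[OF M] null_sets_def)
  then have "?T -` N \<in> null_sets lebesgue"
    using N(2) measurable_sets[OF affine_measurable_lebesgue[OF M, of t], of N]
    by (auto simp: emeasure_distr null_sets_def affine_measurable_lebesgue[OF M])
  then show ?thesis
    by (rule AE_I') (use N(1) in auto)
qed

section \<open>The spaces \<open>L\<^sup>p\<close>\<close>

lemma convex_on_powr_nonneg:
  fixes p :: real
  assumes "1 \<le> p"
  shows "convex_on {0..} (\<lambda>x. x powr p)"
proof (rule convex_on_linorderI)
  fix t x y :: real
  assume t: "0 < t" "t < 1" and xy: "x \<in> {0..}" "y \<in> {0..}" "x < y"
  show "((1 - t) *\<^sub>R x + t *\<^sub>R y) powr p \<le> (1 - t) * x powr p + t * y powr p"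
  proof (cases "x = 0")
    case True
    \<comment> \<open>With one endpoint at 0, convexity reduces to \<open>t powr p \<le> t\<close>
      for \<open>t\<close> between 0 and 1.\<close>
    have "t powr p \<le> t powr 1"
      using t assms by (intro powr_mono') auto
    then have "t powr p * y powr p \<le> t * y powr p"
      using t by (intro mult_right_mono) auto
    then show ?thesis
      using True t xy by (simp add: powr_mult)
  next
    case False
    then show ?thesis
      using convex_onD[OF powr_convex[OF assms], of t x y] t xy by simp
  qed
qed auto

text \<open>Jensen's inequality with the normalized weights \<open>L * w k / s\<close> leaves a
  factor \<open>s powr p\<close>. It may be replaced by \<open>s\<close> because
  \<open>s \<le> 1\<close> or \<open>p = 1\<close>. This is how the hypothesis on the periodization
  enters the norm bounds.\<close>

lemma powr_weighted_sum_le: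
  fixes c w :: "'i \<Rightarrow> real"
  assumes p: "1 \<le> p" and F: "finite F" and L: "0 < L"
    and w: "\<And>k. k \<in> F \<Longrightarrow> 0 \<le> w k" and c: "\<And>k. k \<in> F \<Longrightarrow> 0 \<le> c k"
    and s1: "p = 1 \<or> L * (\<Sum>k\<in>F. w k) \<le> 1"
  shows "(L * (\<Sum>k\<in>F. c k * w k)) powr p \<le> L * (\<Sum>k\<in>F. c k powr p * w k)"
proof -
  define s where "s = L * (\<Sum>k\<in>F. w k)"
  have s0: "0 \<le> s"
    using L w by (auto simp: s_def intro!: mult_nonneg_nonneg sum_nonneg)
  show ?thesis
  proof (cases "s = 0")
    case True
    then have "\<forall>k\<in>F. w k = 0"
      using L F w by (auto simp: s_def sum_nonneg_eq_0_iff)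
    then show ?thesis
      using p by simp
  next
    case False
    then have spos: "0 < s" using s0 by simp
    then have Fne: "F \<noteq> {}" by (auto simp: s_def)
    have nn: "0 \<le> (\<Sum>k\<in>F. L * w k / s * c k)"
      using L w c spos by (auto intro!: sum_nonneg mult_nonneg_nonneg divide_nonneg_nonneg)
    have nn2: "0 \<le> (\<Sum>k\<in>F. L * w k / s * c k powr p)"
      using L w c spos by (auto intro!: sum_nonneg mult_nonneg_nonneg divide_nonneg_nonneg)
    have "(\<Sum>k\<in>F. (L * w k / s) *\<^sub>R c k) powr p \<le> (\<Sum>k\<in>F. L * w k / s * c k powr p)"
    proof (rule convex_on_sum[OF F Fne convex_on_powr_nonneg[OF p]])
      show "(\<Sum>k\<in>F. L * w k / s) = 1"
        unfolding sum_divide_distrib[symmetric] sum_distrib_left[symmetric] s_def[symmetric]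
        using spos by simp
    qed (use L w c spos in auto)
    then have J: "(\<Sum>k\<in>F. L * w k / s * c k) powr p \<le> (\<Sum>k\<in>F. L * w k / s * c k powr p)"
      by simp
    have "L * (\<Sum>k\<in>F. c k * w k) = s * (\<Sum>k\<in>F. L * w k / s * c k)"
      using spos by (simp add: sum_distrib_left mult_ac)
    then have "(L * (\<Sum>k\<in>F. c k * w k)) powr p = s powr p * (\<Sum>k\<in>F. L * w k / s * c k) powr p"
      using s0 nn by (simp add: powr_mult)
    also have "\<dots> \<le> s powr p * (\<Sum>k\<in>F. L * w k / s * c k powr p)"
      using J by (intro mult_left_mono) auto
    also have "\<dots> \<le> s * (\<Sum>k\<in>F. L * w k / s * c k powr p)"
    proof (rule mult_right_mono[OF _ nn2])
      show "s powr p \<le> s"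
      proof (cases "p = 1")
        case False
        then have "s \<le> 1" using s1 by (simp add: s_def)
        then have "s powr p \<le> s powr 1"
          using spos p by (intro powr_mono') auto
        then show ?thesis using spos by simp
      qed (use spos in simp)
    qed
    also have "\<dots> = L * (\<Sum>k\<in>F. c k powr p * w k)"
      using spos by (simp add: sum_distrib_left mult_ac)
    finally show ?thesis .
  qed
qed

lemma powr_inverse_le_iff:
  fixes x y p :: real
  assumes "0 < p" "0 \<le> x" "0 \<le> y"
  shows "x powr (1 / p) \<le> y \<longleftrightarrow> x \<le> y powr p"
proof -
  have "x powr (1 / p) \<le> y \<longleftrightarrow> (x powr (1 / p)) powr p \<le> y powr p"
    using assms powr_mono2[of p "x powr (1 / p)" y] powr_less_mono2[of p y "x powr (1 / p)"]
    by (auto simp: not_le[symmetric])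
  then show ?thesis
    using assms by (simp add: powr_powr)
qed

section \<open>Norms, integrable majorants and Minkowski's inequality\<close>

lemma Lp_norm_nonneg [simp]: "0 \<le> Lp_norm p f"
  by (simp add: Lp_norm_def)

lemma Lp_norm_powr:
  assumes "1 \<le> p"
  shows "Lp_norm p f powr p = (LINT x|lebesgue. norm (f x) powr p)"
  using assms by (simp add: Lp_norm_def powr_powr Bochner_Integration.integral_nonneg)

lemma Lp_spaceD:
  assumes "f \<in> Lp_space p"
  shows "f \<in> borel_measurable lebesgue" "integrable lebesgue (\<lambda>x. norm (f x) powr p)"
  using assms by (auto simp: Lp_space_def)

lemma Lp_bound:
  assumes p: "1 \<le> p" and f: "f \<in> borel_measurable lebesgue" and G: "integrable lebesgue G"
    and le: "AE x in lebesgue. norm (f x) powr p \<le> G x"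
  shows "f \<in> Lp_space p" "Lp_norm p f \<le> (LINT x|lebesgue. G x) powr (1 / p)"
proof -
  have m: "(\<lambda>x. norm (f x) powr p) \<in> borel_measurable lebesgue"
    using f by measurable
  have i: "integrable lebesgue (\<lambda>x. norm (f x) powr p)"
    by (rule Bochner_Integration.integrable_bound[OF G m]) (use le in \<open>auto elim!: eventually_mono\<close>)
  then show "f \<in> Lp_space p"
    using f by (simp add: Lp_space_def)
  show "Lp_norm p f \<le> (LINT x|lebesgue. G x) powr (1 / p)"
    unfolding Lp_norm_def
    by (intro powr_mono2 integral_mono_AE[OF i G le]) (use p in auto)
qed

lemma Lp_cong_AE:
  assumes "f \<in> Lp_space p" "g \<in> borel_measurable lebesgue" "AE x in lebesgue. f x = g x"
  shows "g \<in> Lp_space p" "Lp_norm p g = Lp_norm p f"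
proof -
  have m: "(\<lambda>x. norm (f x) powr p) \<in> borel_measurable lebesgue"
      "(\<lambda>x. norm (g x) powr p) \<in> borel_measurable lebesgue"
    using Lp_spaceD(1)[OF assms(1)] assms(2) by measurable
  have ae: "AE x in lebesgue. norm (f x) powr p = norm (g x) powr p"
    using assms(3) by (auto elim!: eventually_mono)
  show "g \<in> Lp_space p"
    using integrable_cong_AE[OF m ae] assms by (simp add: Lp_space_def)
  show "Lp_norm p g = Lp_norm p f"
    unfolding Lp_norm_def using integral_cong_AE[OF m ae] by simp
qed

lemma Lp_scale:
  assumes "1 \<le> p" "f \<in> Lp_space p"
  shows "(\<lambda>x. c * f x) \<in> Lp_space p" "Lp_norm p (\<lambda>x. c * f x) = norm c * Lp_norm p f"
proof -
  show "(\<lambda>x. c * f x) \<in> Lp_space p"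
    using assms by (auto simp: Lp_space_def norm_mult powr_mult)
  show "Lp_norm p (\<lambda>x. c * f x) = norm c * Lp_norm p f"
    using assms by (simp add: Lp_norm_def norm_mult powr_mult powr_powr Bochner_Integration.integral_nonneg)
qed

lemma Lp_zero: "(\<lambda>x. 0) \<in> Lp_space p" "Lp_norm p (\<lambda>x. 0) = 0"
  by (auto simp: Lp_space_def Lp_norm_def)

text \<open>Minkowski's inequality by convexity. For positive \<open>s\<close> and \<open>t\<close>
  bounding the two norms, \<open>f + g\<close> is \<open>s + t\<close> times the convex combination
  of \<open>f / s\<close> and \<open>g / t\<close> with weight \<open>u = t / (s + t)\<close> on the
  second, and the pth power of this combination has integral at most 1. Taking \<open>s\<close> and
  \<open>t\<close> slightly above the norms avoids division by zero; the excess then tends to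
  0.\<close>

lemma Lp_add:
  assumes p: "1 \<le> p" and f: "f \<in> Lp_space p" and g: "g \<in> Lp_space p"
  shows "(\<lambda>x. f x + g x) \<in> Lp_space p"
    and "Lp_norm p (\<lambda>x. f x + g x) \<le> Lp_norm p f + Lp_norm p g"
proof -
  have m: "(\<lambda>x. f x + g x) \<in> borel_measurable lebesgue"
    using Lp_spaceD(1)[OF f] Lp_spaceD(1)[OF g] by measurable
  have bound: "(\<lambda>x. f x + g x) \<in> Lp_space p \<and> Lp_norm p (\<lambda>x. f x + g x) \<le> s + t"
    if s: "0 < s" "Lp_norm p f \<le> s" and t: "0 < t" "Lp_norm p g \<le> t" for s t
  proof -
    define u where "u = t / (s + t)"
    have u: "0 \<le> u" "u \<le> 1" "(1 - u) * (s + t) = s" "u * (s + t) = t"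
      using s t by (auto simp: u_def field_simps)
    have u34: "(s + t) * ((1 - u) * (a / s) + u * (b / t)) = a + b" for a b
    proof -
      have "z * ((1 - u) * c + u * d) = ((1 - u) * z) * c + (u * z) * d" for z c d
        by algebra
      from this[of "s + t" "a / s" "b / t"] show ?thesis unfolding u(3,4) using s(1) t(1) by simp
    qed
    define G where "G = (\<lambda>x. (s + t) powr p * ((1 - u) / s powr p * norm (f x) powr p
      + u / t powr p * norm (g x) powr p))"
    have G: "integrable lebesgue G"
      unfolding G_def using Lp_spaceD(2)[OF f] Lp_spaceD(2)[OF g] by simp
    have le: "norm (f x + g x) powr p \<le> G x" for x
    proof -
      have "norm (f x + g x) powr p \<le> (norm (f x) + norm (g x)) powr p"
        using p by (intro powr_mono2 norm_triangle_ineq) auto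
      also have "norm (f x) + norm (g x) = (s + t) * ((1 - u) * (norm (f x) / s) + u * (norm (g x) / t))"
        by (rule u34[symmetric])
      also have "\<dots> powr p = (s + t) powr p * ((1 - u) * (norm (f x) / s) + u * (norm (g x) / t)) powr p"
        using s t u by (simp add: powr_mult)
      also have "\<dots> \<le> (s + t) powr p * ((1 - u) * (norm (f x) / s) powr p + u * (norm (g x) / t) powr p)"
        using convex_onD[OF convex_on_powr_nonneg[OF p], of u "norm (f x) / s" "norm (g x) / t"] s t u
        by (intro mult_left_mono) auto
      also have "\<dots> = G x"
        using s t by (simp add: G_def powr_divide)
      finally show ?thesis .
    qed
    have "(LINT x|lebesgue. G x) = (s + t) powr p * ((1 - u) / s powr p * Lp_norm p f powr p
      + u / t powr p * Lp_norm p g powr p)"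
      unfolding G_def using Lp_spaceD(2)[OF f] Lp_spaceD(2)[OF g] p
      by (simp add: Lp_norm_powr)
    also have "\<dots> \<le> (s + t) powr p * ((1 - u) / s powr p * s powr p + u / t powr p * t powr p)"
      using s t u p by (intro mult_left_mono add_mono powr_mono2) auto
    also have "\<dots> = (s + t) powr p"
      using s t by simp
    finally have "(LINT x|lebesgue. G x) powr (1 / p) \<le> s + t"
      using s t p order_trans[OF _ le]
      by (subst powr_inverse_le_iff) (auto intro!: Bochner_Integration.integral_nonneg)
    then show ?thesis
      using Lp_bound[OF p m G] le by force
  qed
  show "(\<lambda>x. f x + g x) \<in> Lp_space p"
    using bound[of "Lp_norm p f + 1" "Lp_norm p g + 1"]
    by (simp add: add_nonneg_pos)
  show "Lp_norm p (\<lambda>x. f x + g x) \<le> Lp_norm p f + Lp_norm p g"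
  proof (rule field_le_epsilon)
    fix e :: real assume "0 < e"
    then show "Lp_norm p (\<lambda>x. f x + g x) \<le> Lp_norm p f + Lp_norm p g + e"
      using bound[of "Lp_norm p f + e / 2" "Lp_norm p g + e / 2"]
      by (simp add: add_nonneg_pos)
  qed
qed

lemma Lp_diff:
  assumes p: "1 \<le> p" and f: "f \<in> Lp_space p" and g: "g \<in> Lp_space p"
  shows "(\<lambda>x. f x - g x) \<in> Lp_space p"
    and "Lp_norm p (\<lambda>x. f x - g x) \<le> Lp_norm p f + Lp_norm p g"
  using Lp_add[OF p f Lp_scale(1)[OF p g, of "- 1"]] Lp_scale(2)[OF p g, of "- 1"] by auto

lemma Lp_norm_minus_commute: "Lp_norm p (\<lambda>x. f x - g x) = Lp_norm p (\<lambda>x. g x - f x)"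
  by (simp add: Lp_norm_def norm_minus_commute)

lemma Lp_norm_triangle:
  assumes p: "1 \<le> p" and f: "f \<in> Lp_space p" "g \<in> Lp_space p" "h \<in> Lp_space p"
  shows "Lp_norm p (\<lambda>x. f x - h x) \<le> Lp_norm p (\<lambda>x. f x - g x) + Lp_norm p (\<lambda>x. g x - h x)"
  using Lp_add(2)[OF p Lp_diff(1)[OF p f(1,2)] Lp_diff(1)[OF p f(2,3)]] by simp

lemma Lp_sum:
  assumes p: "1 \<le> p" and "finite I" "\<And>i. i \<in> I \<Longrightarrow> f i \<in> Lp_space p"
  shows "(\<lambda>x. \<Sum>i\<in>I. f i x) \<in> Lp_space p \<and>
    Lp_norm p (\<lambda>x. \<Sum>i\<in>I. f i x) \<le> (\<Sum>i\<in>I. Lp_norm p (f i))"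
  using assms(2,3)
proof (induction I rule: finite_induct)
  case empty
  then show ?case by (simp add: Lp_zero)
next
  case (insert i I)
  then show ?case
    using Lp_add[OF p, of "f i" "\<lambda>x. \<Sum>i\<in>I. f i x"] by force
qed

section \<open>Density of continuous functions with compact support\<close>

text \<open>The range is an arbitrary normed space because both the complex function
  \<open>u\<close> and the real function \<open>norm (u x) powr p\<close> are to be treated as
  members.\<close>

definition Cc :: "(real ^ 'n \<Rightarrow> 'b::real_normed_vector) set" where
  "Cc = {u. continuous_on UNIV u \<and> (\<exists>r. \<forall>x. r < norm x \<longrightarrow> u x = 0)}"

lemma Cc_support:
  assumes "u \<in> Cc"
  obtains r where "0 < r" "\<And>x. r < norm x \<Longrightarrow> u x = 0"
proof -
  obtain r where r: "\<And>x. r < norm x \<Longrightarrow> u x = 0"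
    using assms by (auto simp: Cc_def)
  show ?thesis
    by (rule that[of "max r 1"]) (auto intro: r)
qed

lemma Cc_bounded:
  assumes "u \<in> Cc"
  obtains B where "0 < B" "\<And>x. norm (u x) \<le> B"
proof -
  obtain r where r: "0 < r" "\<And>x. r < norm x \<Longrightarrow> u x = 0"
    using Cc_support[OF assms] by blast
  have "compact (u ` cball 0 r)"
    using assms by (intro compact_continuous_image) (auto simp: Cc_def intro: continuous_on_subset)
  then obtain B where B: "0 < B" "\<forall>y\<in>u ` cball 0 r. norm y \<le> B"
    using compact_imp_bounded bounded_pos by metis
  show ?thesis
  proof (rule that[OF B(1)])
    show "norm (u x) \<le> B" for x
      using B r(2)[of x] by (cases "r < norm x") auto
  qed
qed

lemma Cc_uniform:
  fixes u :: "real ^ 'n \<Rightarrow> 'b::real_normed_vector"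
  assumes "u \<in> Cc" "0 < e"
  obtains d where "0 < d" "\<And>x y. norm (x - y) \<le> d \<Longrightarrow> norm (u x - u y) \<le> e"
proof -
  obtain r where r: "0 < r" "\<And>x. r < norm x \<Longrightarrow> u x = 0"
    using Cc_support[OF assms(1)] by blast
  have "uniformly_continuous_on (cball 0 (r + 1)) u"
    using assms by (intro compact_uniformly_continuous) (auto simp: Cc_def intro: continuous_on_subset)
  then obtain d where d: "0 < d" "\<And>x y. x \<in> cball 0 (r + 1) \<Longrightarrow> y \<in> cball 0 (r + 1) \<Longrightarrow>
      dist x y < d \<Longrightarrow> dist (u x) (u y) < e"
    using assms(2) unfolding uniformly_continuous_on_def by metis
  \<comment> \<open>The cap \<open>1 / 2\<close> ensures that if one point lies beyond radius
    \<open>r + 1\<close> then both lie beyond \<open>r\<close>, where \<open>u\<close> vanishes.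
    Halving \<open>d\<close> turns a nonstrict inequality into the strict one of uniform
    continuity.\<close>
  show ?thesis
  proof (rule that[of "min (d / 2) (1 / 2)"])
    fix x y :: "real ^ 'n"
    assume xy: "norm (x - y) \<le> min (d / 2) (1 / 2)"
    have n: "norm x \<le> norm y + norm (x - y)" "norm y \<le> norm x + norm (x - y)"
      by (metis diff_add_cancel add.commute norm_triangle_ineq, metis norm_minus_commute diff_add_cancel add.commute norm_triangle_ineq)
    show "norm (u x - u y) \<le> e"
    proof (cases "norm x \<le> r + 1 \<and> norm y \<le> r + 1")
      case True
      then show ?thesis
        using d(2)[of x y] xy d(1) by (auto simp: dist_norm)
    next
      case False
      then have "u x = 0" "u y = 0"
        using n xy by (auto intro!: r(2))
      then show ?thesis using assms(2) by simp
    qed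
  qed (use d in auto)
qed

lemma Cc_norm_powr:
  assumes "u \<in> Cc" "0 < p"
  shows "(\<lambda>x. norm (u x) powr p) \<in> Cc"
  using assms by (auto simp: Cc_def intro!: continuous_intros continuous_on_powr')

lemma Cc_measurable:
  fixes u :: "real ^ 'n \<Rightarrow> 'b::real_normed_vector"
  assumes "u \<in> Cc"
  shows "u \<in> borel_measurable lebesgue"
  using assms continuous_imp_measurable_on_sets_lebesgue[of UNIV u]
  by (auto simp: Cc_def lebesgue_on_UNIV_eq)

lemma Cc_integrable:
  fixes u :: "real ^ 'n \<Rightarrow> real"
  assumes "u \<in> Cc"
  shows "integrable lebesgue u"
proof -
  obtain r where r: "0 < r" "\<And>x. r < norm x \<Longrightarrow> u x = 0"
    using Cc_support[OF assms] by blast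
  obtain B where B: "0 < B" "\<And>x. norm (u x) \<le> B"
    using Cc_bounded[OF assms] by blast
  have "integrable lebesgue (\<lambda>x. B * indicat_real (cball 0 r) x)"
    using lmeasurable_cball[of 0 r] by (intro integrable_mult_right) (simp add: lmeasurable_iff_integrable)
  then show ?thesis
  proof (rule Bochner_Integration.integrable_bound[OF _ Cc_measurable[OF assms]])
    show "AE x in lebesgue. norm (u x) \<le> norm (B * indicat_real (cball 0 r) x)"
      using B r(2) by (intro AE_I2) (auto simp: indicator_def not_le)
  qed
qed

lemma Cc_Lp:
  assumes "u \<in> Cc" "1 \<le> p"
  shows "u \<in> Lp_space p"
  using Cc_integrable[OF Cc_norm_powr[OF assms(1), of p]] Cc_measurable[OF assms(1)] assms(2)
  by (simp add: Lp_space_def)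

lemma Cc_add:
  assumes "u \<in> Cc" "v \<in> Cc"
  shows "(\<lambda>x. u x + v x) \<in> Cc"
proof -
  obtain r s where "\<And>x. r < norm x \<Longrightarrow> u x = 0" "\<And>x. s < norm x \<Longrightarrow> v x = 0"
    using Cc_support assms by metis
  then have "\<forall>x. max r s < norm x \<longrightarrow> u x + v x = 0"
    by auto
  then show ?thesis
    using assms unfolding Cc_def by (blast intro: continuous_on_add)
qed

lemma Cc_scale:
  fixes u :: "real ^ 'n \<Rightarrow> complex"
  assumes "u \<in> Cc"
  shows "(\<lambda>x. c * u x) \<in> Cc"
  using assms by (auto simp: Cc_def intro!: continuous_intros)

text \<open>Density is proved by showing that this set contains the indicators of bounded measurable
  sets and is stable under sums, multiples and limits.\<close>

definition Cc_closure :: "real \<Rightarrow> (real ^ 'n \<Rightarrow> complex) set" where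
  "Cc_closure p = {f \<in> Lp_space p. \<forall>e>0. \<exists>u\<in>Cc. Lp_norm p (\<lambda>x. f x - u x) < e}"

lemma Cc_closureE:
  assumes "f \<in> Cc_closure p" "0 < e"
  obtains u where "u \<in> Cc" "Lp_norm p (\<lambda>x. f x - u x) < e"
  using assms by (auto simp: Cc_closure_def)

lemma Cc_closure_zero: "(\<lambda>x. 0) \<in> Cc_closure p"
proof -
  have "(\<lambda>x::real^'n. 0::complex) \<in> Cc"
    by (auto simp: Cc_def)
  then show ?thesis
    by (auto simp: Cc_closure_def Lp_zero intro!: bexI[of _ "\<lambda>x. 0"])
qed

lemma Cc_closure_add:
  assumes p: "1 \<le> p" and f: "f \<in> Cc_closure p" and g: "g \<in> Cc_closure p"
  shows "(\<lambda>x. f x + g x) \<in> Cc_closure p"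
  unfolding Cc_closure_def
proof (intro CollectI conjI allI impI)
  have fg: "f \<in> Lp_space p" "g \<in> Lp_space p"
    using f g by (auto simp: Cc_closure_def)
  show "(\<lambda>x. f x + g x) \<in> Lp_space p"
    using fg Lp_add(1)[OF p] by blast
  fix e :: real assume "0 < e"
  then have e2: "0 < e / 2" by simp
  obtain u where u: "u \<in> Cc" "Lp_norm p (\<lambda>x. f x - u x) < e / 2"
    using Cc_closureE[OF f e2] by blast
  obtain v where v: "v \<in> Cc" "Lp_norm p (\<lambda>x. g x - v x) < e / 2"
    using Cc_closureE[OF g e2] by blast
  have "Lp_norm p (\<lambda>x. (f x - u x) + (g x - v x)) \<le>
      Lp_norm p (\<lambda>x. f x - u x) + Lp_norm p (\<lambda>x. g x - v x)"
    by (intro Lp_add(2) Lp_diff(1) p fg Cc_Lp[OF u(1) p] Cc_Lp[OF v(1) p])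
  also have "\<dots> < e" using u(2) v(2) by simp
  finally have "Lp_norm p (\<lambda>x. f x + g x - (u x + v x)) < e"
    by (simp add: algebra_simps)
  then show "\<exists>u\<in>Cc. Lp_norm p (\<lambda>x. f x + g x - u x) < e"
    using Cc_add[OF u(1) v(1)] by (intro bexI[of _ "\<lambda>x. u x + v x"]) auto
qed

lemma Cc_closure_scale:
  assumes p: "1 \<le> p" and f: "f \<in> Cc_closure p"
  shows "(\<lambda>x. c * f x) \<in> Cc_closure p"
  unfolding Cc_closure_def
proof (intro CollectI conjI allI impI)
  have fL: "f \<in> Lp_space p"
    using f by (auto simp: Cc_closure_def)
  show "(\<lambda>x. c * f x) \<in> Lp_space p"
    by (rule Lp_scale(1)[OF p fL])
  fix e :: real assume e: "0 < e"
  then have "0 < e / (norm c + 1)"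
    by (simp add: add_nonneg_pos)
  then obtain u where u: "u \<in> Cc" "Lp_norm p (\<lambda>x. f x - u x) < e / (norm c + 1)"
    using Cc_closureE[OF f] by blast
  have "Lp_norm p (\<lambda>x. c * f x - c * u x) = norm c * Lp_norm p (\<lambda>x. f x - u x)"
    using Lp_scale(2)[OF p Lp_diff(1)[OF p fL Cc_Lp[OF u(1) p]], of c] by (simp add: algebra_simps)
  also have "\<dots> \<le> (norm c + 1) * Lp_norm p (\<lambda>x. f x - u x)"
    by (intro mult_right_mono) auto
  also have "\<dots> < e"
    using u(2) e by (simp add: pos_less_divide_eq add_nonneg_pos mult.commute)
  finally show "\<exists>u\<in>Cc. Lp_norm p (\<lambda>x. c * f x - u x) < e"
    by (intro bexI[of _ "\<lambda>x. c * u x"] Cc_scale u(1))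
qed

lemma Cc_closure_sum:
  assumes p: "1 \<le> p" and "finite I" "\<And>i. i \<in> I \<Longrightarrow> f i \<in> Cc_closure p"
  shows "(\<lambda>x. \<Sum>i\<in>I. f i x) \<in> Cc_closure p"
  using assms(2,3) by (induction I rule: finite_induct) (auto intro!: Cc_closure_zero Cc_closure_add p)

lemma Cc_closure_limit:
  assumes p: "1 \<le> p" and f: "f \<in> Lp_space p" and h: "\<And>i. h i \<in> Cc_closure p"
    and lim: "(\<lambda>i. Lp_norm p (\<lambda>x. f x - h i x)) \<longlonglongrightarrow> 0"
  shows "f \<in> Cc_closure p"
  unfolding Cc_closure_def
proof (intro CollectI conjI allI impI f)
  fix e :: real assume e: "0 < e"
  have "eventually (\<lambda>i. Lp_norm p (\<lambda>x. f x - h i x) < e / 2) sequentially"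
    by (rule order_tendstoD(2)[OF lim]) (use e in simp)
  then obtain i where i: "Lp_norm p (\<lambda>x. f x - h i x) < e / 2"
    by (meson eventually_sequentially order_refl)
  obtain u where u: "u \<in> Cc" "Lp_norm p (\<lambda>x. h i x - u x) < e / 2"
    using Cc_closureE[OF h[of i], of "e / 2"] e by auto
  have "h i \<in> Lp_space p"
    using h[of i] by (auto simp: Cc_closure_def)
  then have "Lp_norm p (\<lambda>x. f x - u x) < e"
    using Lp_norm_triangle[OF p f _ Cc_Lp[OF u(1) p], of "h i"] i u(2) by simp
  then show "\<exists>u\<in>Cc. Lp_norm p (\<lambda>x. f x - u x) < e"
    using u(1) by blast
qed

text \<open>By regularity, \<open>E\<close> lies between a closed \<open>K\<close> and an open
  \<open>U\<close> with small gaps. A Urysohn function equal to 1 on \<open>K\<close> and 0 outside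
  \<open>U\<close> differs from the indicator by at most 1, and only on the two gaps. Intersecting
  \<open>U\<close> with a ball around \<open>E\<close> makes the support bounded.\<close>

lemma Cc_closure_indicator:
  fixes E :: "(real ^ 'n) set"
  assumes p: "1 \<le> p" and E: "E \<in> sets lebesgue" "bounded E"
  shows "(\<lambda>x. of_real (indicator E x)) \<in> Cc_closure p"
  unfolding Cc_closure_def
proof (intro CollectI conjI allI impI)
  have Em: "E \<in> lmeasurable"
    using E bounded_set_imp_lmeasurable by blast
  have fm: "(\<lambda>x. of_real (indicator E x) :: complex) \<in> borel_measurable lebesgue"
    using E(1) by measurable
  have "norm (of_real (indicator E x) :: complex) powr p \<le> indicat_real E x" for x
    by (auto simp: indicator_def)
  then show "(\<lambda>x. of_real (indicator E x)) \<in> Lp_space p"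
    using Em by (intro Lp_bound(1)[OF p fm, of "indicat_real E"]) (auto simp: lmeasurable_iff_integrable)
  fix e :: real assume e: "0 < e"
  \<comment> \<open>Each of the two gaps \<open>U - E\<close> and \<open>E - K\<close> gets half of
    \<open>(e / 2) powr p\<close>, so that the norm of the error is at most
    \<open>e / 2\<close>.\<close>
  define s where "s = (e / 2) powr p / 2"
  have s: "0 < s" using e by (simp add: s_def)
  obtain K where K: "closed K" "K \<subseteq> E" "E - K \<in> lmeasurable" "emeasure lebesgue (E - K) < ennreal s"
    using sets_lebesgue_inner_closed[OF E(1) s] by blast
  obtain U where U: "open U" "E \<subseteq> U" "U - E \<in> lmeasurable" "emeasure lebesgue (U - E) < ennreal s"
    using sets_lebesgue_outer_open[OF E(1) s] by blast
  obtain r where r: "E \<subseteq> ball 0 r"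
    using E(2) bounded_subset_ballD by blast
  let ?V = "U \<inter> ball 0 r"
  have disj: "K \<inter> - ?V = {}" using K(2) U(2) r by blast
  obtain g :: "real ^ 'n \<Rightarrow> real" where g: "continuous_on UNIV g" "\<And>x. g x \<in> closed_segment 1 0"
      "\<And>x. x \<in> K \<Longrightarrow> g x = 1" "\<And>x. x \<in> - ?V \<Longrightarrow> g x = 0"
    using Urysohn[OF K(1) _ disj, of 1 0] U(1) by blast
  have g01: "0 \<le> g x" "g x \<le> 1" for x
    using g(2)[of x] by (auto simp: closed_segment_eq_real_ivl)
  let ?u = "\<lambda>x. of_real (g x) :: complex"
  have u: "?u \<in> Cc"
    unfolding Cc_def using g(1) g(4) by (auto intro!: continuous_intros exI[of _ r])
  let ?W = "(U - E) \<union> (E - K)"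
  have W: "?W \<in> lmeasurable" using U(3) K(3) by blast
  have le: "norm (of_real (indicator E x) - ?u x) powr p \<le> indicat_real ?W x" for x
  proof (cases "x \<in> ?W")
    case True
    have "norm (of_real (indicator E x) - ?u x) = \<bar>indicator E x - g x\<bar>"
      by (metis norm_of_real of_real_diff)
    also have "\<dots> \<le> 1" using g01[of x] by (auto simp: indicator_def)
    finally have "norm (of_real (indicator E x) - ?u x) powr p \<le> 1 powr p"
      using p by (intro powr_mono2) auto
    then show ?thesis using True by simp
  next
    case False
    then have "x \<in> K \<or> x \<in> - U" by blast
    then have "of_real (indicator E x) = ?u x"
      using g(3,4)[of x] K(2) U(2) by (auto simp: indicator_def)
    then show ?thesis by simp
  qed
  have um: "?u \<in> borel_measurable lebesgue" by (rule Cc_measurable[OF u])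
  have "Lp_norm p (\<lambda>x. of_real (indicator E x) - ?u x) \<le> (LINT x|lebesgue. indicat_real ?W x) powr (1 / p)"
    by (rule Lp_bound(2)[OF p]) (use fm um W le in \<open>auto simp: lmeasurable_iff_integrable\<close>)
  also have "\<dots> \<le> e / 2"
  proof -
    have "measure lebesgue (U - E) \<le> s" "measure lebesgue (E - K) \<le> s"
      unfolding measure_def using U(4) K(4) s by (intro enn2real_leI less_imp_le; simp)+
    then have "measure lebesgue ?W \<le> (e / 2) powr p"
      using measure_Un_le[of "U - E" lebesgue "E - K"] U(3) K(3) by (simp add: s_def fmeasurable_def)
    then show ?thesis
      using p e by (subst powr_inverse_le_iff) auto
  qed
  also have "e / 2 < e" using e by simp
  finally show "\<exists>u\<in>Cc. Lp_norm p (\<lambda>x. of_real (indicator E x) - u x) < e"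
    by (intro bexI[of _ ?u] u)
qed

lemma Cc_dense:
  fixes f :: "real ^ 'n \<Rightarrow> complex"
  assumes p: "1 \<le> p" and f: "f \<in> Lp_space p"
  shows "f \<in> Cc_closure p"
proof -
  have fm: "f \<in> borel_measurable lebesgue" by (rule Lp_spaceD(1)[OF f])
  obtain s where s: "\<And>i. simple_function lebesgue (s i)" "\<And>x. (\<lambda>i. s i x) \<longlonglongrightarrow> f x"
      "\<And>i x. norm (s i x) \<le> 2 * norm (f x)"
    using borel_measurable_implies_sequence_metric[OF fm, of 0] by (auto simp: dist_norm)
  \<comment> \<open>Cutting the simple approximations off outside growing balls makes their level
    sets bounded, as \<open>Cc_closure_indicator\<close> requires; the pointwise limit is
    unaffected.\<close>
  define h where "h = (\<lambda>(i::nat) x. s i x * of_real (indicator (cball 0 (real i)) x))"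
  have h_closure: "h i \<in> Cc_closure p" for i
  proof -
    have fin: "finite (range (s i))"
      using simple_functionD(1)[OF s(1)[of i]] by simp
    have "h i = (\<lambda>x. \<Sum>y\<in>range (s i). y * of_real (indicator (s i -` {y} \<inter> cball 0 (real i)) x))"
    proof
      fix x
      have "(\<Sum>y\<in>range (s i). y * of_real (indicator (s i -` {y} \<inter> cball 0 (real i)) x)) =
          (\<Sum>y\<in>range (s i). if y = s i x then s i x * of_real (indicator (cball 0 (real i)) x) else 0)"
        by (intro sum.cong) (auto simp: indicator_def)
      then show "h i x = (\<Sum>y\<in>range (s i). y * of_real (indicator (s i -` {y} \<inter> cball 0 (real i)) x))"
        using fin by (simp add: h_def sum.delta)
    qed
    moreover have "s i -` {y} \<inter> cball 0 (real i) \<in> sets lebesgue" for y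
      using simple_functionD(2)[OF s(1)[of i], of "{y}"] by auto
    moreover have "bounded (s i -` {y} \<inter> cball 0 (real i))" for y
      by (rule bounded_subset[OF bounded_cball]) blast
    ultimately show ?thesis
      using fin by (auto intro!: Cc_closure_sum Cc_closure_scale Cc_closure_indicator p)
  qed
  have h_lim: "(\<lambda>i. h i x) \<longlonglongrightarrow> f x" for x
  proof (rule Lim_transform_eventually[OF s(2)[of x]])
    obtain N where "norm x \<le> real N" using real_arch_simple by blast
    then have "\<forall>i\<ge>N. s i x = h i x"
      by (auto simp: h_def indicator_def)
    then show "\<forall>\<^sub>F i in sequentially. s i x = h i x"
      by (auto simp: eventually_sequentially)
  qed
  have h_m: "h i \<in> borel_measurable lebesgue" for i
    using h_closure[of i] by (auto simp: Cc_closure_def Lp_space_def)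
  have "(\<lambda>i. LINT x|lebesgue. norm (f x - h i x) powr p) \<longlonglongrightarrow> (LINT x|(lebesgue :: (real^'n) measure). 0)"
  proof (rule integral_dominated_convergence)
    show "(\<lambda>x. 0) \<in> borel_measurable lebesgue" by simp
    show "(\<lambda>x. norm (f x - h i x) powr p) \<in> borel_measurable lebesgue" for i
      using fm h_m[of i] by measurable
    \<comment> \<open>Since \<open>norm (h i x)\<close> is at most twice \<open>norm (f x)\<close>,
      the difference is at most three times \<open>norm (f x)\<close>.\<close>
    show "integrable lebesgue (\<lambda>x. 3 powr p * norm (f x) powr p)"
      using Lp_spaceD(2)[OF f] by simp
    show "AE x in lebesgue. (\<lambda>i. norm (f x - h i x) powr p) \<longlonglongrightarrow> 0"
    proof (intro AE_I2)
      fix x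
      have "(\<lambda>i. norm (f x - h i x)) \<longlonglongrightarrow> norm (f x - f x)"
        by (intro tendsto_intros h_lim)
      then show "(\<lambda>i. norm (f x - h i x) powr p) \<longlonglongrightarrow> 0"
        using p by (intro tendsto_zero_powrI[where b = p]) auto
    qed
    show "AE x in lebesgue. norm (norm (f x - h i x) powr p) \<le> 3 powr p * norm (f x) powr p" for i
    proof (intro AE_I2)
      fix x
      have "norm (h i x) \<le> 2 * norm (f x)"
        using s(3)[of i x] by (auto simp: h_def indicator_def norm_mult)
      then have "norm (f x - h i x) \<le> 3 * norm (f x)"
        using norm_triangle_ineq4[of "f x" "h i x"] by simp
      then have "norm (f x - h i x) powr p \<le> (3 * norm (f x)) powr p"
        using p by (intro powr_mono2) auto
      then show "norm (norm (f x - h i x) powr p) \<le> 3 powr p * norm (f x) powr p"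
        by (simp add: powr_mult)
    qed
  qed
  then have "(\<lambda>i. LINT x|lebesgue. norm (f x - h i x) powr p) \<longlonglongrightarrow> 0"
    by simp
  then have "(\<lambda>i. Lp_norm p (\<lambda>x. f x - h i x)) \<longlonglongrightarrow> 0"
    unfolding Lp_norm_def using p
    by (intro tendsto_zero_powrI[where b = "1 / p"]) (auto intro!: Bochner_Integration.integral_nonneg)
  then show ?thesis
    by (rule Cc_closure_limit[OF p f h_closure])
qed

section \<open>Sampling on a lattice\<close>

lemma norm_matrix_le: "norm ((A :: real ^ 'n ^ 'n) *v x) \<le> onorm ((*v) A) * norm x"
  by (rule onorm) simp

lemma onorm_matrix_nonneg: "0 \<le> onorm ((*v) (A :: real ^ 'n ^ 'n))"
  by (rule onorm_pos_le) simp

lemma invertible_matrix_inv: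
  assumes "invertible A"
  shows "invertible (matrix_inv A)"
  using matrix_inv_mult[OF assms] by (auto simp: invertible_def)

lemma det_matrix_inv:
  fixes A :: "real ^ 'n ^ 'n"
  assumes "invertible A"
  shows "det (matrix_inv A) = 1 / det A"
proof -
  have "det A * det (matrix_inv A) = 1"
    using matrix_inv_mult(1)[OF assms] by (metis det_mul det_I)
  then show ?thesis
    by (metis mult_eq_0_iff nonzero_eq_divide_eq mult.commute zero_neq_one)
qed

lemma matrix_inv_cancel:
  fixes A :: "real ^ 'n ^ 'n"
  assumes "invertible A"
  shows "matrix_inv A *v (A *v x) = x" "A *v (matrix_inv A *v x) = x"
  by (simp_all add: matrix_vector_mul_assoc matrix_inv_mult[OF assms])

lemma invertible_mat1: "invertible (mat 1 :: real ^ 'n ^ 'n)"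
  by (simp add: invertible_det_nz)

lemma lattice_vec_diff: "lattice_vec (k - l) = lattice_vec k - lattice_vec l"
  by (simp add: lattice_vec_def vec_eq_iff)

section \<open>Lattice points, sample points and sampling errors\<close>

lemma finite_lattice_ball: "finite {k :: int ^ 'n. norm (lattice_vec k) \<le> r}"
proof -
  let ?S = "{- \<lceil>r\<rceil>..\<lceil>r\<rceil>}"
  have "vec_nth ` {k :: int ^ 'n. norm (lattice_vec k) \<le> r} \<subseteq> UNIV \<rightarrow>\<^sub>E ?S"
  proof (clarsimp simp: PiE_def)
    fix k :: "int ^ 'n" and i
    assume "norm (lattice_vec k) \<le> r"
    then have "\<bar>real_of_int (k $ i)\<bar> \<le> r"
      using component_le_norm_cart[of "lattice_vec k" i] by (simp add: lattice_vec_def)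
    then show "- \<lceil>r\<rceil> \<le> k $ i \<and> k $ i \<le> \<lceil>r\<rceil>"
      by linarith
  qed
  moreover have "finite (UNIV \<rightarrow>\<^sub>E ?S :: ('n \<Rightarrow> int) set)"
    by (intro finite_PiE) auto
  ultimately show ?thesis
    using finite_imageD[OF finite_subset] by (metis (no_types, lifting) inj_onI vec_nth_inject)
qed

text \<open>The number of overlapping translates has to be bounded uniformly in \<open>y\<close>, so
  that the periodization of a bounded function with bounded support is bounded. If \<open>l\<close>
  is one of the indices counted, the differences \<open>k - l\<close> all lie in a ball that does
  not depend on \<open>y\<close>, and this ball contains finitely many lattice points.\<close>

lemma lattice_overlap:
  fixes b :: "real ^ 'n ^ 'n"
  assumes b: "invertible b"
  obtains N :: nat where
    "\<And>F y. finite F \<Longrightarrow> card {k \<in> F. norm (y - b *v lattice_vec k) \<le> R} \<le> N"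
proof -
  define s where "s = onorm ((*v) (matrix_inv b)) * R"
  let ?K = "{k :: int ^ 'n. norm (lattice_vec k) \<le> s + s}"
  have "card {k \<in> F. norm (y - b *v lattice_vec k) \<le> R} \<le> card ?K" if "finite F" for F y
  proof (cases "{k \<in> F. norm (y - b *v lattice_vec k) \<le> R} = {}")
    case False
    let ?G = "{k \<in> F. norm (y - b *v lattice_vec k) \<le> R}"
    have le: "norm (matrix_inv b *v y - lattice_vec k) \<le> s" if "k \<in> ?G" for k
    proof -
      have "matrix_inv b *v y - lattice_vec k = matrix_inv b *v (y - b *v lattice_vec k)"
        by (simp add: matrix_vector_mult_diff_distrib matrix_inv_cancel[OF b])
      also have "norm \<dots> \<le> onorm ((*v) (matrix_inv b)) * norm (y - b *v lattice_vec k)"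
        by (rule norm_matrix_le)
      also have "\<dots> \<le> s"
        using that unfolding s_def by (intro mult_left_mono onorm_matrix_nonneg) auto
      finally show ?thesis .
    qed
    obtain l where l: "l \<in> ?G" using False by blast
    have "(\<lambda>k. k - l) ` ?G \<subseteq> ?K"
    proof clarify
      fix k assume "k \<in> F" "norm (y - b *v lattice_vec k) \<le> R"
      then have k: "k \<in> ?G" by blast
      have "lattice_vec (k - l) = (matrix_inv b *v y - lattice_vec l) - (matrix_inv b *v y - lattice_vec k)"
        by (simp add: lattice_vec_diff)
      also have "norm \<dots> \<le> s + s"
        using le[OF k] le[OF l] norm_triangle_ineq4 by (meson add_mono order_trans)
      finally show "norm (lattice_vec (k - l)) \<le> s + s" .
    qed
    moreover have "inj_on (\<lambda>k. k - l) ?G"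
      by (auto simp: inj_on_def)
    ultimately show ?thesis
      using card_inj_on_le finite_lattice_ball by blast
  next
    case True
    then show ?thesis by (simp only: card.empty)
  qed
  then show ?thesis using that by blast
qed

text \<open>The point that \<open>A\<close> sends to the lattice point
  \<open>b *v lattice_vec k\<close>. If \<open>w\<close> has bounded support and the inverse of
  \<open>A\<close> is small, the \<open>k\<close>th translate of \<open>w\<close>, rescaled by
  \<open>A\<close>, is concentrated near it.\<close>

definition sample_point :: "real ^ 'n ^ 'n \<Rightarrow> real ^ 'n ^ 'n \<Rightarrow> int ^ 'n \<Rightarrow> real ^ 'n" where
  "sample_point A b k = matrix_inv A *v (b *v lattice_vec k)"

lemma sample_point_dist:
  assumes "invertible A"
  shows "norm (x - sample_point A b k) \<le> onorm ((*v) (matrix_inv A)) * norm (A *v x - b *v lattice_vec k)"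
proof -
  have "x - sample_point A b k = matrix_inv A *v (A *v x - b *v lattice_vec k)"
    by (simp add: sample_point_def matrix_vector_mult_diff_distrib matrix_inv_cancel[OF assms])
  then show ?thesis
    by (metis norm_matrix_le)
qed

lemma finite_sample_points:
  assumes "invertible A" "invertible b"
  shows "finite {k. norm (sample_point A b k) \<le> r}"
proof -
  let ?s = "onorm ((*v) (matrix_inv b)) * (onorm ((*v) A) * r)"
  have "norm (lattice_vec k) \<le> ?s" if "norm (sample_point A b k) \<le> r" for k
  proof -
    have "lattice_vec k = matrix_inv b *v (A *v sample_point A b k)"
      by (simp add: sample_point_def matrix_inv_cancel assms)
    also have "norm \<dots> \<le> onorm ((*v) (matrix_inv b)) * norm (A *v sample_point A b k)"
      by (rule norm_matrix_le)
    also have "\<dots> \<le> onorm ((*v) (matrix_inv b)) * (onorm ((*v) A) * norm (sample_point A b k))"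
      by (intro mult_left_mono norm_matrix_le onorm_matrix_nonneg)
    also have "\<dots> \<le> ?s"
      using that by (intro mult_left_mono onorm_matrix_nonneg)
    finally show ?thesis .
  qed
  then show ?thesis
    by (intro finite_subset[OF _ finite_lattice_ball[of ?s]]) auto
qed

text \<open>Only indices \<open>k\<close> with \<open>A *v x\<close> within \<open>R\<close> of the
  lattice point contribute. For these, \<open>x\<close> is within \<open>d\<close> of the sample
  point, so \<open>v\<close> changes by at most \<open>e\<close>. As \<open>d \<le> 1\<close>, both
  values of \<open>v\<close> vanish when \<open>x\<close> lies beyond radius \<open>r + 1\<close>,
  which confines the error to a set of finite measure.\<close>

lemma sampling_error_pointwise:
  fixes v :: "real ^ 'n \<Rightarrow> 'b::real_normed_vector" and w :: "real ^ 'n \<Rightarrow> real"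
  assumes A: "invertible A"
    and supp: "\<And>x. r < norm x \<Longrightarrow> v x = 0"
    and osc: "\<And>x y. norm (x - y) \<le> d \<Longrightarrow> norm (v x - v y) \<le> e"
    and w: "\<And>y. 0 \<le> w y" "\<And>y. R < norm y \<Longrightarrow> w y = 0"
    and small: "onorm ((*v) (matrix_inv A)) * R \<le> d" "d \<le> 1"
  shows "norm ((\<Sum>k\<in>F. w (A *v x - b *v lattice_vec k)) *\<^sub>R v x
        - (\<Sum>k\<in>F. w (A *v x - b *v lattice_vec k) *\<^sub>R v (sample_point A b k)))
    \<le> e * (\<Sum>k\<in>F. w (A *v x - b *v lattice_vec k)) * indicator (cball 0 (r + 1)) x"
proof -
  let ?w = "\<lambda>k. w (A *v x - b *v lattice_vec k)"
  have one: "norm (?w k *\<^sub>R (v x - v (sample_point A b k))) \<le> e * ?w k * indicator (cball 0 (r + 1)) x" for k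
  proof (cases "?w k = 0")
    case False
    then have "norm (A *v x - b *v lattice_vec k) \<le> R"
      using w(2) by (meson not_le)
    then have "onorm ((*v) (matrix_inv A)) * norm (A *v x - b *v lattice_vec k) \<le> d"
      using small(1) mult_left_mono[OF _ onorm_matrix_nonneg] by (meson order_trans)
    then have dist: "norm (x - sample_point A b k) \<le> d"
      using sample_point_dist[OF A] by (meson order_trans)
    show ?thesis
    proof (cases "x \<in> cball 0 (r + 1)")
      case True
      then show ?thesis
        using osc[OF dist] w(1) by (simp add: mult.commute mult_right_mono)
    next
      case False
      have "norm x \<le> norm (sample_point A b k) + norm (x - sample_point A b k)"
        by (metis add.commute diff_add_cancel norm_triangle_ineq)
      then have "r < norm x" "r < norm (sample_point A b k)"
        using False dist small(2) by auto
      then show ?thesis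
        using supp False by simp
    qed
  qed simp
  have "norm ((\<Sum>k\<in>F. ?w k) *\<^sub>R v x - (\<Sum>k\<in>F. ?w k *\<^sub>R v (sample_point A b k))) =
      norm (\<Sum>k\<in>F. ?w k *\<^sub>R (v x - v (sample_point A b k)))"
    by (simp add: scaleR_sum_left sum_subtractf scaleR_diff_right)
  also have "\<dots> \<le> (\<Sum>k\<in>F. e * ?w k * indicator (cball 0 (r + 1)) x)"
    by (intro sum_norm_le one)
  also have "\<dots> = e * (\<Sum>k\<in>F. ?w k) * indicator (cball 0 (r + 1)) x"
    by (simp add: sum_distrib_left sum_distrib_right)
  finally show ?thesis .
qed

lemma translate_integral:
  fixes A b :: "real ^ 'n ^ 'n" and w :: "real ^ 'n \<Rightarrow> real"
  assumes A: "invertible A" and w: "integrable lebesgue w" "\<And>y. 0 \<le> w y"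
  shows "integrable lebesgue (\<lambda>x. w (A *v x - z))"
    and "(LINT x|lebesgue. w (A *v x - z)) = (LINT x|lebesgue. w x) / \<bar>det A\<bar>"
  using integral_affine[OF A w, of "- z"] by simp_all

text \<open>Every translate of \<open>w\<close>, rescaled by \<open>A\<close>, has integral
  \<open>1 / \<bar>det A\<bar>\<close> times that of \<open>w\<close>. Integrating the pointwise
  estimate therefore compares the integral of \<open>v\<close> against the finite periodization with
  a Riemann sum of \<open>v\<close> times the mean of \<open>w\<close>.\<close>

lemma sampling_error_integral:
  fixes v :: "real ^ 'n \<Rightarrow> real" and w :: "real ^ 'n \<Rightarrow> real" and b :: "real ^ 'n ^ 'n"
  assumes A: "invertible A" and v: "v \<in> Cc"
    and supp: "\<And>x. r < norm x \<Longrightarrow> v x = 0"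
    and osc: "\<And>x y. norm (x - y) \<le> d \<Longrightarrow> norm (v x - v y) \<le> e"
    and w: "integrable lebesgue w" "\<And>y. 0 \<le> w y" "\<And>y. R < norm y \<Longrightarrow> w y = 0"
    and small: "onorm ((*v) (matrix_inv A)) * R \<le> d" "d \<le> 1" and e: "0 \<le> e"
    and F: "finite F"
    and H: "AE x in lebesgue. L * (\<Sum>k\<in>F. w (A *v x - b *v lattice_vec k)) \<le> H" and L: "0 \<le> L"
  shows "integrable lebesgue (\<lambda>x. v x * (L * (\<Sum>k\<in>F. w (A *v x - b *v lattice_vec k))))"
    and "\<bar>(LINT x|lebesgue. v x * (L * (\<Sum>k\<in>F. w (A *v x - b *v lattice_vec k))))
      - L / \<bar>det A\<bar> * (\<Sum>k\<in>F. v (sample_point A b k)) * (LINT x|lebesgue. w x)\<bar>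
      \<le> e * H * measure lebesgue (cball (0 :: real ^ 'n) (r + 1))"
proof -
  let ?w = "\<lambda>k x. w (A *v x - b *v lattice_vec k)"
  let ?B = "cball (0 :: real ^ 'n) (r + 1)"
  have iw: "integrable lebesgue (?w k)" "(LINT x|lebesgue. ?w k x) = (LINT x|lebesgue. w x) / \<bar>det A\<bar>" for k
    using translate_integral[OF A w(1,2)] by auto
  obtain C where C: "0 < C" "\<And>x. norm (v x) \<le> C"
    using Cc_bounded[OF v] by blast
  have vm: "v \<in> borel_measurable lebesgue" by (rule Cc_measurable[OF v])
  have ih: "integrable lebesgue (\<lambda>x. L * (\<Sum>k\<in>F. ?w k x))"
    using iw(1) by simp
  show int: "integrable lebesgue (\<lambda>x. v x * (L * (\<Sum>k\<in>F. ?w k x)))"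
  proof (rule Bochner_Integration.integrable_bound[where f="\<lambda>x. C * (L * (\<Sum>k\<in>F. ?w k x))"])
    show "integrable lebesgue (\<lambda>x. C * (L * (\<Sum>k\<in>F. ?w k x)))"
      using ih by simp
    show "(\<lambda>x. v x * (L * (\<Sum>k\<in>F. ?w k x))) \<in> borel_measurable lebesgue"
      using vm borel_measurable_integrable[OF ih] by (rule borel_measurable_times)
    show "AE x in lebesgue. norm (v x * (L * (\<Sum>k\<in>F. ?w k x))) \<le> norm (C * (L * (\<Sum>k\<in>F. ?w k x)))"
      using C by (intro AE_I2) (auto simp: abs_mult intro!: mult_right_mono)
  qed
  let ?s = "\<lambda>x. L * (\<Sum>k\<in>F. ?w k x * v (sample_point A b k))"
  have ints: "integrable lebesgue ?s"
    using iw(1) by simp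
  have "(LINT x|lebesgue. ?s x) = L * (\<Sum>k\<in>F. (LINT x|lebesgue. w x) / \<bar>det A\<bar> * v (sample_point A b k))"
    using iw by simp
  also have "\<dots> = L / \<bar>det A\<bar> * (\<Sum>k\<in>F. v (sample_point A b k)) * (LINT x|lebesgue. w x)"
    by (simp add: sum_distrib_left sum_distrib_right mult_ac)
  finally have s: "(LINT x|lebesgue. ?s x) = \<dots>" .
  have "AE x in lebesgue. \<bar>v x * (L * (\<Sum>k\<in>F. ?w k x)) - ?s x\<bar> \<le> e * H * indicat_real ?B x"
    using H
  proof eventually_elim
    case (elim x)
    have "\<bar>v x * (L * (\<Sum>k\<in>F. ?w k x)) - ?s x\<bar> =
        L * norm ((\<Sum>k\<in>F. ?w k x) *\<^sub>R v x - (\<Sum>k\<in>F. ?w k x *\<^sub>R v (sample_point A b k)))"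
    proof -
      have "v x * (L * (\<Sum>k\<in>F. ?w k x)) - ?s x =
          L * ((\<Sum>k\<in>F. ?w k x) * v x - (\<Sum>k\<in>F. ?w k x * v (sample_point A b k)))"
        by (simp add: algebra_simps)
      then show ?thesis using L by (simp only: abs_mult real_norm_def real_scaleR_def abs_of_nonneg)
    qed
    also have "\<dots> \<le> L * (e * (\<Sum>k\<in>F. ?w k x) * indicat_real ?B x)"
      using sampling_error_pointwise[where F=F and x=x and b=b, OF A supp osc w(2,3) small] L
      by (intro mult_left_mono) auto
    also have "\<dots> = (L * (\<Sum>k\<in>F. ?w k x)) * (e * indicat_real ?B x)"
      by simp
    also have "\<dots> \<le> H * (e * indicat_real ?B x)"
      using elim e by (intro mult_right_mono) auto
    finally show ?case by (simp add: mult_ac)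
  qed
  moreover have iB: "integrable lebesgue (\<lambda>x. e * H * indicat_real ?B x)"
    using lmeasurable_cball[of "0 :: real ^ 'n" "r + 1"] by (intro integrable_mult_right) (simp add: lmeasurable_iff_integrable)
  ultimately have "\<bar>LINT x|lebesgue. v x * (L * (\<Sum>k\<in>F. ?w k x)) - ?s x\<bar> \<le> (LINT x|lebesgue. e * H * indicat_real ?B x)"
    using int ints
    by (intro order_trans[OF integral_abs_bound] integral_mono_AE) auto
  also have "\<dots> = e * H * measure lebesgue ?B"
    by simp
  finally show "\<bar>(LINT x|lebesgue. v x * (L * (\<Sum>k\<in>F. ?w k x)))
      - L / \<bar>det A\<bar> * (\<Sum>k\<in>F. v (sample_point A b k)) * (LINT x|lebesgue. w x)\<bar>
      \<le> e * H * measure lebesgue ?B"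
    using int ints by (simp only: Bochner_Integration.integral_diff s)
qed

section \<open>Tiling by unit cells, Riemann sums and integrals of periodizations\<close>

definition unit_cell :: "(real ^ 'n) set" where
  "unit_cell = {y. \<forall>i. 0 \<le> y $ i \<and> y $ i < 1}"

lemma unit_cell_measure: "(unit_cell :: (real ^ 'n) set) \<in> lmeasurable" "measure lebesgue (unit_cell :: (real ^ 'n) set) = 1"
proof -
  let ?C = "cbox 0 1 :: (real ^ 'n) set"
  have "unit_cell \<subseteq> ?C" "box 0 1 \<subseteq> (unit_cell :: (real ^ 'n) set)"
    by (auto simp: unit_cell_def mem_box_cart less_imp_le)
  then have neg: "negligible ((?C - unit_cell) \<union> (unit_cell - ?C))"
    by (intro negligible_subset[OF negligible_frontier_interval[of 0 "1 :: real ^ 'n"]]) auto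
  show "(unit_cell :: (real ^ 'n) set) \<in> lmeasurable"
    using lmeasurable_negligible_symdiff[OF _ neg] by simp
  have "?C \<noteq> {}" by (simp add: interval_ne_empty_cart)
  then show "measure lebesgue (unit_cell :: (real ^ 'n) set) = 1"
    using measure_negligible_symdiff[OF _ neg] by (simp add: content_cbox_cart)
qed

text \<open>Because the cell is half-open, its integer translates partition the space exactly and
  not merely up to null sets; the floor of each coordinate names the translate.\<close>

lemma unit_cell_unique: "y - lattice_vec k \<in> unit_cell \<longleftrightarrow> k = (\<chi> i. \<lfloor>y $ i\<rfloor>)"
proof -
  have "0 \<le> y $ i - of_int (k $ i) \<and> y $ i - of_int (k $ i) < 1 \<longleftrightarrow> k $ i = \<lfloor>y $ i\<rfloor>" for i
    by (auto simp: floor_eq_iff[symmetric] eq_commute[of "k $ i"]) linarith+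
  then show ?thesis
    by (auto simp: unit_cell_def lattice_vec_def vec_eq_iff)
qed

lemma unit_cell_norm: "y \<in> (unit_cell :: (real ^ 'n) set) \<Longrightarrow> norm y \<le> real CARD('n)"
proof -
  assume "y \<in> unit_cell"
  then have "(\<Sum>i\<in>UNIV. \<bar>y $ i\<bar>) \<le> (\<Sum>i\<in>(UNIV :: 'n set). 1)"
    by (intro sum_mono) (auto simp: unit_cell_def less_imp_le abs_le_iff) 
  then show ?thesis
    using norm_le_l1_cart[of y] by simp
qed

text \<open>
  This is \<open>sampling_error_integral\<close> for \<open>w\<close> the normalized indicator of the cell \<open>b[0,1)\<^sup>n\<close>, whose translates
  tile the space.
\<close>

lemma riemann_sum_error:
  fixes v :: "real ^ 'n \<Rightarrow> real" and b :: "real ^ 'n ^ 'n"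
  assumes A: "invertible A" and b: "invertible b" and v: "v \<in> Cc"
    and supp: "\<And>x. r < norm x \<Longrightarrow> v x = 0"
    and osc: "\<And>x y. norm (x - y) \<le> d \<Longrightarrow> norm (v x - v y) \<le> e"
    and small: "onorm ((*v) (matrix_inv A)) * (onorm ((*v) b) * real CARD('n)) \<le> d" "d \<le> 1" and e: "0 \<le> e"
    and F: "finite F" "{k. norm (sample_point A b k) \<le> r + 1} \<subseteq> F"
  shows "\<bar>(LINT x|lebesgue. v x) - \<bar>det b\<bar> / \<bar>det A\<bar> * (\<Sum>k\<in>F. v (sample_point A b k))\<bar>
      \<le> e * measure lebesgue (cball (0 :: real ^ 'n) (r + 1))"
proof -
  let ?L = "\<bar>det b\<bar>"
  let ?R = "onorm ((*v) b) * real CARD('n)"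
  let ?ib = "matrix_inv b"
  have L: "0 < ?L" using b by (simp add: invertible_det_nz)
  \<comment> \<open>The image of the unit cell under \<open>b\<close> has measure
    \<open>\<bar>det b\<bar>\<close>, so this normalization gives integral 1 and makes the
    periodization identically 1.\<close>
  define w where "w = (\<lambda>y. indicat_real unit_cell (?ib *v y) / ?L)"
  have ic: "integrable lebesgue (indicat_real (unit_cell :: (real ^ 'n) set))"
    using unit_cell_measure(1) by (simp add: lmeasurable_iff_integrable)
  have wint: "integrable lebesgue w" "(LINT y|lebesgue. w y) = 1"
    using integral_affine[OF invertible_matrix_inv[OF b] ic, of 0] unit_cell_measure L
    by (auto simp: w_def det_matrix_inv[OF b] fmeasurableD)
  have wsupp: "w y = 0" if "?R < norm y" for y
  proof (rule ccontr)
    assume "w y \<noteq> 0"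
    then have "?ib *v y \<in> unit_cell" by (auto simp: w_def indicator_def split: if_splits)
    then have "norm (?ib *v y) \<le> real CARD('n)" by (rule unit_cell_norm)
    then have "onorm ((*v) b) * norm (?ib *v y) \<le> ?R"
      by (intro mult_left_mono onorm_matrix_nonneg)
    then show False
      using norm_matrix_le[of b "?ib *v y"] that by (simp add: matrix_inv_cancel[OF b])
  qed
  have h: "?L * (\<Sum>k\<in>F. w (A *v x - b *v lattice_vec k)) =
      (if (\<chi> i. \<lfloor>(?ib *v (A *v x)) $ i\<rfloor>) \<in> F then 1 else 0)" for x
  proof -
    have "?L * (\<Sum>k\<in>F. w (A *v x - b *v lattice_vec k)) =
        (\<Sum>k\<in>F. indicat_real unit_cell (?ib *v (A *v x) - lattice_vec k))"
      using L by (simp add: w_def sum_distrib_left matrix_vector_mult_diff_distrib matrix_inv_cancel[OF b])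
    also have "\<dots> = (\<Sum>k\<in>F. if k = (\<chi> i. \<lfloor>(?ib *v (A *v x)) $ i\<rfloor>) then 1 else 0)"
      by (intro sum.cong) (auto simp: indicator_def unit_cell_unique)
    finally show ?thesis using F(1) by simp
  qed
  \<comment> \<open>The finite sum equals 1 wherever \<open>v\<close> may be nonzero: the cell
    containing such an \<open>x\<close> belongs to a sample point at distance at most 1, hence
    within radius \<open>r + 1\<close>, and \<open>F\<close> contains all those indices.\<close>
  have hv: "v x * (?L * (\<Sum>k\<in>F. w (A *v x - b *v lattice_vec k))) = v x" for x
  proof (cases "r < norm x")
    case False
    define k where "k = (\<chi> i. \<lfloor>(?ib *v (A *v x)) $ i\<rfloor>)"
    have "?ib *v (A *v x) - lattice_vec k \<in> unit_cell"
      by (simp add: unit_cell_unique k_def)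
    then have "w (A *v x - b *v lattice_vec k) \<noteq> 0"
      using L by (simp add: w_def matrix_vector_mult_diff_distrib matrix_inv_cancel[OF b])
    then have "norm (A *v x - b *v lattice_vec k) \<le> ?R"
      using wsupp by (meson not_le)
    then have "onorm ((*v) (matrix_inv A)) * norm (A *v x - b *v lattice_vec k) \<le> 1"
      using small mult_left_mono[OF _ onorm_matrix_nonneg] by (meson order_trans)
    then have "norm (x - sample_point A b k) \<le> 1"
      using sample_point_dist[OF A] by (meson order_trans)
    moreover have "norm (sample_point A b k) \<le> norm x + norm (x - sample_point A b k)"
      by (metis add.commute diff_add_cancel norm_minus_commute norm_triangle_ineq)
    ultimately have "k \<in> F" using False F(2) by auto
    then show ?thesis by (simp add: h k_def)
  qed (simp add: supp)
  have H: "AE x in lebesgue. ?L * (\<Sum>k\<in>F. w (A *v x - b *v lattice_vec k)) \<le> 1"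
    by (simp add: h)
  have w0: "0 \<le> w y" for y by (simp add: w_def)
  show ?thesis
    using sampling_error_integral(2)[OF A v supp osc wint(1) w0 wsupp small e F(1) H less_imp_le[OF L]]
    unfolding hv wint(2) by simp
qed

text \<open>Turns sums over the lattice into integrals over counting measure, where Tonelli's
  theorem allows sums and integrals of nonnegative functions to be interchanged.\<close>

lemma nn_integral_count_space_infsum:
  fixes f :: "'i \<Rightarrow> real"
  assumes "f summable_on A" "\<And>x. x \<in> A \<Longrightarrow> 0 \<le> f x"
  shows "(\<integral>\<^sup>+x. ennreal (f x) \<partial>count_space A) = ennreal (infsum f A)"
proof -
  have "(\<lambda>x. norm (f x)) summable_on A"
    using assms by (subst summable_on_cong[of A _ f]) auto
  then have a: "Infinite_Set_Sum.abs_summable_on f A"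
    using abs_summable_equivalent by blast
  then show ?thesis
    using nn_integral_conv_infsetsum[OF a] assms(2) infsetsum_infsum[OF a] by simp
qed

text \<open>Unfolding: the integral of \<open>w\<close> is split over the translated cells, every
  piece is moved into the same cell, and the sum is taken inside the integral. There it equals
  \<open>1 / \<bar>det b\<bar>\<close> almost everywhere, while the cell has measure
  \<open>\<bar>det b\<bar>\<close>. For \<open>p > 1\<close> this supplies the integral of
  \<open>\<psi>\<close> from its periodization.\<close>

lemma integral_of_periodization:
  fixes w :: "real ^ 'n \<Rightarrow> real" and b :: "real ^ 'n ^ 'n"
  assumes b: "invertible b" and w: "w \<in> borel_measurable lebesgue" "\<And>x. 0 \<le> w x"
    and P: "AE x in lebesgue. (\<lambda>k. w (x - b *v lattice_vec k)) summable_on UNIV \<and>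
      \<bar>det b\<bar> * (\<Sum>\<^sub>\<infinity>k. w (x - b *v lattice_vec k)) = 1"
  shows "integrable lebesgue w" "(LINT x|lebesgue. w x) = 1"
proof -
  let ?L = "\<bar>det b\<bar>"
  let ?ib = "matrix_inv b"
  let ?C = "unit_cell :: (real ^ 'n) set"
  have L: "0 < ?L" using b by (simp add: invertible_det_nz)
  have Cm: "?C \<in> sets lebesgue" using unit_cell_measure(1) by (rule fmeasurableD)
  have Im: "(\<lambda>x. indicator ?C (?ib *v x + t) :: ennreal) \<in> borel_measurable lebesgue" for t
    by (rule borel_measurable_affine[OF invertible_matrix_inv[OF b]]) (use Cm in simp)
  have wm: "(\<lambda>x. ennreal (w (x - t))) \<in> borel_measurable lebesgue" for t
    using borel_measurable_affine[OF _ w(1), of "mat 1" "- t"] by (simp add: invertible_mat1)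
  have one: "(\<integral>\<^sup>+k. indicator ?C (?ib *v x + lattice_vec k) \<partial>count_space UNIV) = (1::ennreal)" for x
  proof -
    \<comment> \<open>The cells carry a plus sign so that replacing \<open>x\<close> by
      \<open>x - b *v lattice_vec k\<close> frees the indicator from \<open>k\<close>; hence the
      negated floor.\<close>
    let ?k = "- (\<chi> i. \<lfloor>(?ib *v x) $ i\<rfloor>)"
    have "?ib *v x + lattice_vec k \<in> ?C \<longleftrightarrow> k = ?k" for k
    proof -
      have "lattice_vec (- k) = - lattice_vec k"
        by (simp add: lattice_vec_def vec_eq_iff)
      then show ?thesis
        using unit_cell_unique[of "?ib *v x" "- k"] by (metis diff_minus_eq_add minus_minus)
    qed
    then have "indicator ?C (?ib *v x + lattice_vec k) = (indicator {?k} k :: ennreal)" for k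
      by (simp add: indicator_def)
    then show ?thesis by (simp add: nn_integral_count_space_indicator[symmetric])
  qed
  have "(\<integral>\<^sup>+x. w x \<partial>lebesgue) =
      (\<integral>\<^sup>+x. \<integral>\<^sup>+k. ennreal (w x) * indicator ?C (?ib *v x + lattice_vec k) \<partial>count_space UNIV \<partial>lebesgue)"
    by (simp add: nn_integral_cmult one)
  also have "\<dots> = (\<integral>\<^sup>+k. \<integral>\<^sup>+x. ennreal (w x) * indicator ?C (?ib *v x + lattice_vec k) \<partial>lebesgue \<partial>count_space UNIV)"
    using wm[of 0] Im by (intro nn_integral_count_space_nn_integral) auto
  also have "\<dots> = (\<integral>\<^sup>+k. \<integral>\<^sup>+x. ennreal (w (x - b *v lattice_vec k)) * indicator ?C (?ib *v x) \<partial>lebesgue \<partial>count_space UNIV)"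
  proof (rule nn_integral_cong)
    fix k :: "int ^ 'n"
    let ?F = "\<lambda>x. ennreal (w x) * indicator ?C (?ib *v x + lattice_vec k)"
    have "(\<integral>\<^sup>+x. ?F (mat 1 *v x + - (b *v lattice_vec k)) \<partial>lebesgue) = ennreal (1 / \<bar>det (mat 1 :: real^'n^'n)\<bar>) * (\<integral>\<^sup>+x. ?F x \<partial>lebesgue)"
      using wm[of 0] Im by (intro nn_integral_affine) (auto simp: invertible_mat1)
    then show "(\<integral>\<^sup>+x. ?F x \<partial>lebesgue) =
        (\<integral>\<^sup>+x. ennreal (w (x - b *v lattice_vec k)) * indicator ?C (?ib *v x) \<partial>lebesgue)"
      by (simp add: matrix_vector_mult_diff_distrib matrix_inv_cancel[OF b])
  qed
  also have "\<dots> = (\<integral>\<^sup>+x. \<integral>\<^sup>+k. ennreal (w (x - b *v lattice_vec k)) * indicator ?C (?ib *v x) \<partial>count_space UNIV \<partial>lebesgue)"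
    using wm Im[of 0] by (intro nn_integral_count_space_nn_integral[symmetric]) auto
  also have "\<dots> = (\<integral>\<^sup>+x. ennreal (1 / ?L) * indicator ?C (?ib *v x) \<partial>lebesgue)"
  proof (rule nn_integral_cong_AE)
    show "AE x in lebesgue. (\<integral>\<^sup>+k. ennreal (w (x - b *v lattice_vec k)) * indicator ?C (?ib *v x) \<partial>count_space UNIV) =
        ennreal (1 / ?L) * indicator ?C (?ib *v x)"
      using P
    proof eventually_elim
      case (elim x)
      have "(\<integral>\<^sup>+k. ennreal (w (x - b *v lattice_vec k)) \<partial>count_space UNIV) =
          ennreal (\<Sum>\<^sub>\<infinity>k. w (x - b *v lattice_vec k))"
        using elim w(2) by (intro nn_integral_count_space_infsum) auto
      also have "(\<Sum>\<^sub>\<infinity>k. w (x - b *v lattice_vec k)) = 1 / ?L"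
        using elim L by (simp add: field_simps)
      finally show ?case
        by (simp add: nn_integral_multc)
    qed
  qed
  also have "\<dots> = ennreal (1 / ?L) * (\<integral>\<^sup>+x. indicator ?C (?ib *v x) \<partial>lebesgue)"
    using Im[of 0] by (intro nn_integral_cmult) simp
  also have "\<dots> = ennreal (1 / ?L) * (ennreal ?L * emeasure lebesgue ?C)"
    using nn_integral_affine[OF invertible_matrix_inv[OF b], of "indicator ?C" 0] Cm
    by (simp add: det_matrix_inv[OF b])
  also have "\<dots> = 1"
    using L unit_cell_measure[where 'n='n]
    by (simp add: emeasure_eq_measure2 ennreal_mult'[symmetric])
  finally have eq: "(\<integral>\<^sup>+x. w x \<partial>lebesgue) = 1" .
  show "integrable lebesgue w"
    by (rule integrableI_nonneg[OF w(1)]) (use w(2) eq in auto)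
  show "(LINT x|lebesgue. w x) = 1"
    using integral_eq_nn_integral[OF w(1)] w(2) eq by simp
qed

section \<open>A single dilation level\<close>

text \<open>This covers divergent families too: \<open>infsum\<close> is then 0, and the empty set
  gives \<open>0 \<le> B\<close>. So \<open>level_bound\<close> can proceed without first proving
  that the sum over \<open>k\<close> converges.\<close>

lemma norm_infsum_le_finite_sums:
  fixes f :: "'i \<Rightarrow> 'b::real_normed_vector"
  assumes "\<And>F. finite F \<Longrightarrow> norm (\<Sum>k\<in>F. f k) \<le> B"
  shows "norm (\<Sum>\<^sub>\<infinity>k. f k) \<le> B"
proof (cases "f summable_on UNIV")
  case True
  then have "(f has_sum (\<Sum>\<^sub>\<infinity>k. f k)) UNIV"
    by (rule has_sum_infsum)
  then have "((\<lambda>F. norm (sum f F)) \<longlongrightarrow> norm (\<Sum>\<^sub>\<infinity>k. f k)) (finite_subsets_at_top UNIV)"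
    unfolding has_sum_def by (rule tendsto_norm)
  then show ?thesis
    by (rule tendsto_upperbound) (auto intro!: eventually_finite_subsets_at_top_weakI assms)
next
  case False
  then show ?thesis
    using assms[of "{}"] by (simp add: infsum_not_exists)
qed

text \<open>
  The real function \<open>w\<close> represents \<open>\<psi>\<close> and is nonnegative everywhere, not only almost everywhere.
  The last assumption is all that is kept of the identity \<open>P\<psi> = 1\<close>.
\<close>

locale affine_synthesis =
  fixes p :: real and b :: "real ^ 'n ^ 'n" and \<psi> :: "real ^ 'n \<Rightarrow> complex"
    and w :: "real ^ 'n \<Rightarrow> real"
  assumes p: "1 \<le> p" and b: "invertible b"
    and psi_Lp: "\<psi> \<in> Lp_space p"
    and psi_w: "AE x in lebesgue. \<psi> x = of_real (w x)"
    and w_nonneg: "\<And>x. 0 \<le> w x"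
    and w_int: "integrable lebesgue w" "(LINT x|lebesgue. w x) = 1"
    and w_per: "p = 1 \<or> (AE x in lebesgue. \<forall>F. finite F \<longrightarrow>
      \<bar>det b\<bar> * (\<Sum>k\<in>F. w (x - b *v lattice_vec k)) \<le> 1)"
begin

abbreviation "L \<equiv> \<bar>det b\<bar>"

lemma L_pos: "0 < L"
  using b by (simp add: invertible_det_nz)

definition level :: "real ^ 'n ^ 'n \<Rightarrow> (int ^ 'n \<Rightarrow> complex) \<Rightarrow> real ^ 'n \<Rightarrow> complex" where
  "level A c x = (\<Sum>\<^sub>\<infinity>k. c k * (of_real (\<bar>det A\<bar> powr (1 / p)) * \<psi> (A *v x - b *v lattice_vec k)))"

text \<open>As \<open>1 - 1 / p\<close> is \<open>1 / q\<close>, this is the norm of the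
  coefficients of one level with the constant of the theorem absorbed. The theorem then says that
  the norm of \<open>f\<close> is the infimum of the total cost.\<close>

definition cost :: "(int ^ 'n \<Rightarrow> complex) \<Rightarrow> real" where
  "cost c = L powr (- (1 - 1 / p)) * (\<Sum>\<^sub>\<infinity>k. norm (c k) powr p) powr (1 / p)"

lemma cost_nonneg: "0 \<le> cost c"
  by (simp add: cost_def)

lemma psi_translates:
  fixes A :: "real ^ 'n ^ 'n"
  assumes "invertible A"
  shows "AE x in lebesgue. \<forall>k. \<psi> (A *v x - b *v lattice_vec k) = of_real (w (A *v x - b *v lattice_vec k))"
  unfolding AE_all_countable
  using AE_affine[OF assms psi_w, of "- (b *v lattice_vec k)" for k] by simp

lemma per_translates:
  fixes A :: "real ^ 'n ^ 'n"
  assumes "invertible A"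
  shows "p = 1 \<or> (AE x in lebesgue. \<forall>F. finite F \<longrightarrow> L * (\<Sum>k\<in>F. w (A *v x - b *v lattice_vec k)) \<le> 1)"
  using w_per AE_affine[OF assms, of _ 0] by auto

lemma L_powr: "x \<ge> 0 \<Longrightarrow> (L powr (- (1 - 1 / p)) * x) powr p = L powr (1 - p) * x powr p"
proof -
  have "- (1 - 1 / p) * p = 1 - p"
    using p by (simp add: field_simps)
  then show "x \<ge> 0 \<Longrightarrow> (L powr (- (1 - 1 / p)) * x) powr p = L powr (1 - p) * x powr p"
    by (simp add: powr_mult powr_powr)
qed

lemma jensen_level:
  assumes "finite F" "p = 1 \<or> L * (\<Sum>k\<in>F. v k) \<le> 1" "\<And>k. 0 \<le> v k" "0 \<le> D"
  shows "norm (\<Sum>k\<in>F. c k * (of_real (D powr (1 / p)) * of_real (v k))) powr p \<le>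
    D * L powr (1 - p) * (\<Sum>k\<in>F. norm (c k :: complex) powr p * v k)"
proof -
  have "norm (\<Sum>k\<in>F. c k * (of_real (D powr (1 / p)) * of_real (v k))) \<le>
      (\<Sum>k\<in>F. norm (c k) * (D powr (1 / p) * v k))"
    using assms(3) by (intro sum_norm_le) (simp add: norm_mult)
  \<comment> \<open>A factor \<open>L\<close> is split off to match the weighted Jensen inequality.
    Its reciprocal contributes \<open>L powr - p\<close>, which combines with the \<open>L\<close>
    produced there to \<open>L powr (1 - p)\<close>.\<close>
  also have "\<dots> = D powr (1 / p) / L * (L * (\<Sum>k\<in>F. norm (c k) * v k))"
    using L_pos by (simp add: sum_distrib_left mult_ac)
  finally have "norm (\<Sum>k\<in>F. c k * (of_real (D powr (1 / p)) * of_real (v k))) powr p \<le>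
      (D powr (1 / p) / L * (L * (\<Sum>k\<in>F. norm (c k) * v k))) powr p"
    using p by (intro powr_mono2) auto
  also have "\<dots> = (D powr (1 / p) / L) powr p * (L * (\<Sum>k\<in>F. norm (c k) * v k)) powr p"
    by (rule powr_mult)
  also have "\<dots> \<le> (D powr (1 / p) / L) powr p * (L * (\<Sum>k\<in>F. norm (c k) powr p * v k))"
    using assms L_pos p by (intro mult_left_mono powr_weighted_sum_le) auto
  also have "(D powr (1 / p) / L) powr p = (D powr (1 / p)) powr p / L powr p"
    by (rule powr_divide)
  also have "\<dots> = D * L powr - p"
    using p assms(4) by (simp add: powr_powr powr_minus divide_inverse)
  also have "D * L powr - p * (L * (\<Sum>k\<in>F. norm (c k) powr p * v k)) =
      D * L powr (1 - p) * (\<Sum>k\<in>F. norm (c k) powr p * v k)"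
    using L_pos by (simp add: powr_diff powr_minus divide_inverse)
  finally show ?thesis .
qed

text \<open>The finite Jensen estimate passes to infinite sums with values in the extended reals,
  where nothing is to be shown if the right-hand side is infinite. In the integral every translate
  contributes \<open>1 / \<bar>det A\<bar>\<close>, which cancels the normalization of the affine
  system.\<close>

lemma level_bound:
  assumes A: "invertible A" and c: "(\<lambda>k. norm (c k) powr p) summable_on UNIV"
    and m: "level A c \<in> borel_measurable lebesgue"
  shows "Lp_norm p (level A c) \<le> cost c"
proof -
  let ?D = "\<bar>det A\<bar>"
  let ?w = "\<lambda>k x. w (A *v x - b *v lattice_vec k)"
  let ?s = "\<Sum>\<^sub>\<infinity>k. norm (c k) powr p"
  have D: "0 < ?D" using A by (simp add: invertible_det_nz)
  have K: "0 \<le> ?D * L powr (1 - p)" by simp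
  have s: "0 \<le> ?s" by (intro infsum_nonneg) auto
  have wm: "?w k \<in> borel_measurable lebesgue" for k
    using translate_integral(1)[OF A w_int(1) w_nonneg] by (rule borel_measurable_integrable)
  have pt: "ennreal (norm (level A c x) powr p) \<le> ennreal (?D * L powr (1 - p)) *
      (\<integral>\<^sup>+k. ennreal (norm (c k) powr p * ?w k x) \<partial>count_space UNIV)"
    if psi: "\<forall>k. \<psi> (A *v x - b *v lattice_vec k) = of_real (?w k x)"
      and per: "p = 1 \<or> (\<forall>F. finite F \<longrightarrow> L * (\<Sum>k\<in>F. ?w k x) \<le> 1)" for x
  proof (cases "(\<integral>\<^sup>+k. ennreal (norm (c k) powr p * ?w k x) \<partial>count_space UNIV) = \<infinity>")
    case True
    then show ?thesis using D L_pos by (simp add: ennreal_mult_top)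
  next
    case False
    then obtain q where q: "0 \<le> q" "(\<integral>\<^sup>+k. ennreal (norm (c k) powr p * ?w k x) \<partial>count_space UNIV) = ennreal q"
      by (cases "\<integral>\<^sup>+k. ennreal (norm (c k) powr p * ?w k x) \<partial>count_space UNIV") auto
    let ?B = "?D * L powr (1 - p) * q"
    have B: "0 \<le> ?B" using q(1) by simp
    have "norm (\<Sum>k\<in>F. c k * (of_real (?D powr (1 / p)) * \<psi> (A *v x - b *v lattice_vec k))) \<le> ?B powr (1 / p)"
      if F: "finite F" for F
    proof -
      have "ennreal (\<Sum>k\<in>F. norm (c k) powr p * ?w k x) = (\<integral>\<^sup>+k. ennreal (norm (c k) powr p * ?w k x) \<partial>count_space F)"
        using F w_nonneg by (simp add: nn_integral_count_space_finite sum_ennreal)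
      also have "\<dots> \<le> ennreal q"
        unfolding q(2)[symmetric] by (subst nn_integral_count_space_indicator)
          (auto intro!: nn_integral_mono simp: indicator_def)
      finally have "(\<Sum>k\<in>F. norm (c k) powr p * ?w k x) \<le> q"
        using q(1) by (simp add: ennreal_le_iff)
      then have "norm (\<Sum>k\<in>F. c k * (of_real (?D powr (1 / p)) * of_real (?w k x))) powr p \<le> ?B"
        using jensen_level[OF F, of "\<lambda>k. ?w k x" ?D c] per F w_nonneg mult_left_mono[OF _ K]
        by (meson abs_ge_zero order_trans)
      then have "(norm (\<Sum>k\<in>F. c k * (of_real (?D powr (1 / p)) * of_real (?w k x))) powr p) powr (1 / p) \<le> ?B powr (1 / p)"
        using p by (intro powr_mono2) auto
      then show ?thesis
        using p psi by (simp add: powr_powr)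
    qed
    then have "norm (level A c x) \<le> ?B powr (1 / p)"
      unfolding level_def by (rule norm_infsum_le_finite_sums)
    then have "norm (level A c x) powr p \<le> (?B powr (1 / p)) powr p"
      using p by (intro powr_mono2) auto
    then have "norm (level A c x) powr p \<le> ?B"
      using p B by (simp add: powr_powr)
    then show ?thesis
      using q K by (simp add: ennreal_mult'[symmetric])
  qed
  have ae: "AE x in lebesgue. ennreal (norm (level A c x) powr p) \<le> ennreal (?D * L powr (1 - p)) *
      (\<integral>\<^sup>+k. ennreal (norm (c k) powr p * ?w k x) \<partial>count_space UNIV)"
    using per_translates[OF A]
  proof
    assume "p = 1"
    then show ?thesis
      using psi_translates[OF A] pt by (auto elim!: eventually_mono)
  next
    assume "AE x in lebesgue. \<forall>F. finite F \<longrightarrow> L * (\<Sum>k\<in>F. ?w k x) \<le> 1"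
    with psi_translates[OF A] show ?thesis
      by eventually_elim (use pt in auto)
  qed
  have "(\<integral>\<^sup>+x. ennreal (norm (level A c x) powr p) \<partial>lebesgue) \<le>
      (\<integral>\<^sup>+x. ennreal (?D * L powr (1 - p)) *
      (\<integral>\<^sup>+k. ennreal (norm (c k) powr p * ?w k x) \<partial>count_space UNIV) \<partial>lebesgue)"
    by (rule nn_integral_mono_AE[OF ae])
  also have "\<dots> = ennreal (?D * L powr (1 - p)) *
      (\<integral>\<^sup>+x. \<integral>\<^sup>+k. ennreal (norm (c k) powr p * ?w k x) \<partial>count_space UNIV \<partial>lebesgue)"
  proof (rule nn_integral_cmult)
    \<comment> \<open>The index set is countably infinite, so enumerating it turns the integral over
      counting measure into a series of measurable functions.\<close>
    have "(\<lambda>x. \<integral>\<^sup>+k. ennreal (norm (c k) powr p * ?w k x) \<partial>count_space UNIV) =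
        (\<lambda>x. \<Sum>n. ennreal (norm (c (from_nat_into UNIV n)) powr p * ?w (from_nat_into UNIV n) x))"
      if "infinite (UNIV :: (int ^ 'n) set)"
      using bij_betw_from_nat_into[OF _ that] 
      by (simp add: nn_integral_bij_count_space[symmetric] nn_integral_count_space_nat)
    moreover have "infinite (UNIV :: (int ^ 'n) set)"
    proof
      assume "finite (UNIV :: (int ^ 'n) set)"
      then have "finite (range (\<lambda>i::int. (\<chi> _. i) :: int ^ 'n))" by (rule finite_subset[rotated]) simp
      moreover have "inj (\<lambda>i::int. (\<chi> _. i) :: int ^ 'n)"
        by (auto simp: inj_def vec_eq_iff)
      ultimately show False
        using finite_imageD infinite_UNIV_int by blast
    qed
    ultimately show "(\<lambda>x. \<integral>\<^sup>+k. ennreal (norm (c k) powr p * ?w k x) \<partial>count_space UNIV) \<in> borel_measurable lebesgue"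
      using wm by simp
  qed
  also have "(\<integral>\<^sup>+x. \<integral>\<^sup>+k. ennreal (norm (c k) powr p * ?w k x) \<partial>count_space UNIV \<partial>lebesgue) =
      (\<integral>\<^sup>+k. \<integral>\<^sup>+x. ennreal (norm (c k) powr p * ?w k x) \<partial>lebesgue \<partial>count_space UNIV)"
    using wm by (intro nn_integral_count_space_nn_integral) auto
  also have "\<dots> = (\<integral>\<^sup>+k. ennreal (1 / ?D) * ennreal (norm (c k) powr p) \<partial>count_space UNIV)"
  proof (rule nn_integral_cong)
    fix k
    have "(\<integral>\<^sup>+x. ennreal (norm (c k) powr p * ?w k x) \<partial>lebesgue) =
        ennreal (LINT x|lebesgue. norm (c k) powr p * ?w k x)"
      using translate_integral(1)[OF A w_int(1) w_nonneg] w_nonneg by (intro nn_integral_eq_integral) auto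
    also have "(LINT x|lebesgue. norm (c k) powr p * ?w k x) = norm (c k) powr p / ?D"
      using translate_integral(2)[OF A w_int(1) w_nonneg] w_int(2) by simp
    finally show "(\<integral>\<^sup>+x. ennreal (norm (c k) powr p * ?w k x) \<partial>lebesgue) =
        ennreal (1 / ?D) * ennreal (norm (c k) powr p)"
      by (simp add: ennreal_mult'[symmetric])
  qed
  also have "\<dots> = ennreal (1 / ?D) * ennreal ?s"
    using nn_integral_count_space_infsum[OF c] by (simp add: nn_integral_cmult)
  also have "ennreal (?D * L powr (1 - p)) * (ennreal (1 / ?D) * ennreal ?s) = ennreal (L powr (1 - p) * ?s)"
    using D s by (simp add: ennreal_mult'[symmetric])
  finally have le: "(\<integral>\<^sup>+x. ennreal (norm (level A c x) powr p) \<partial>lebesgue) \<le> ennreal (L powr (1 - p) * ?s)" .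
  have "Lp_norm p (level A c) powr p = (LINT x|lebesgue. norm (level A c x) powr p)"
    by (rule Lp_norm_powr[OF p])
  also have "\<dots> = enn2real (\<integral>\<^sup>+x. ennreal (norm (level A c x) powr p) \<partial>lebesgue)"
    using m by (intro integral_eq_nn_integral) auto
  also have "\<dots> \<le> L powr (1 - p) * ?s"
    using le s by (intro enn2real_leI) auto
  also have "\<dots> = cost c powr p"
    unfolding cost_def using p s by (subst L_powr) (auto simp: powr_powr)
  finally have "Lp_norm p (level A c) powr p \<le> cost c powr p" .
  then show ?thesis
    using powr_less_mono2[of p "cost c" "Lp_norm p (level A c)"] p cost_nonneg[of c]
    by fastforce
qed

lemma level_finite:
  assumes A: "invertible A" and F: "finite F" "\<And>k. k \<notin> F \<Longrightarrow> c k = 0"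
  shows "level A c x = (\<Sum>k\<in>F. c k * (of_real (\<bar>det A\<bar> powr (1 / p)) * \<psi> (A *v x - b *v lattice_vec k)))"
    and "level A c \<in> Lp_space p"
    and "cost c = L powr (- (1 - 1 / p)) * (\<Sum>k\<in>F. norm (c k) powr p) powr (1 / p)"
proof -
  have eq: "level A c x = (\<Sum>k\<in>F. c k * (of_real (\<bar>det A\<bar> powr (1 / p)) * \<psi> (A *v x - b *v lattice_vec k)))" for x
    unfolding level_def using F by (subst infsum_finite[OF F(1), symmetric]) (intro infsum_cong_neutral, auto)
  then show "level A c x = (\<Sum>k\<in>F. c k * (of_real (\<bar>det A\<bar> powr (1 / p)) * \<psi> (A *v x - b *v lattice_vec k)))" .
  have "(\<lambda>x. \<psi> (A *v x - b *v lattice_vec k)) \<in> Lp_space p" for k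
    using integral_affine(1)[OF A Lp_spaceD(2)[OF psi_Lp], of "- (b *v lattice_vec k)"]
      borel_measurable_affine[OF A Lp_spaceD(1)[OF psi_Lp], of "- (b *v lattice_vec k)"]
    by (simp add: Lp_space_def)
  then have "(\<lambda>x. c k * (of_real (\<bar>det A\<bar> powr (1 / p)) * \<psi> (A *v x - b *v lattice_vec k))) \<in> Lp_space p" for k
    by (intro Lp_scale(1) p)
  then have "(\<lambda>x. \<Sum>k\<in>F. c k * (of_real (\<bar>det A\<bar> powr (1 / p)) * \<psi> (A *v x - b *v lattice_vec k))) \<in> Lp_space p"
    by (intro conjunct1[OF Lp_sum[OF p F(1)]])
  moreover have "level A c = (\<lambda>x. \<Sum>k\<in>F. c k * (of_real (\<bar>det A\<bar> powr (1 / p)) * \<psi> (A *v x - b *v lattice_vec k)))"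
    using eq by blast
  ultimately show "level A c \<in> Lp_space p" by simp
  show "cost c = L powr (- (1 - 1 / p)) * (\<Sum>k\<in>F. norm (c k) powr p) powr (1 / p)"
  proof -
    have "(\<Sum>\<^sub>\<infinity>k. norm (c k) powr p) = (\<Sum>\<^sub>\<infinity>k\<in>F. norm (c k) powr p)"
      using F(2) by (intro infsum_cong_neutral) auto
    then show ?thesis
      using F(1) by (simp add: cost_def)
  qed
qed

text \<open>The bound \<open>H\<close> on the truncated periodization is the reciprocal of the damping factor \<open>\<delta>\<close>.\<close>

lemma truncation:
  assumes t: "0 < t"
  obtains w0 R H where "integrable lebesgue w0" "\<And>y. 0 \<le> w0 y" "\<And>y. w0 y \<le> w y"
    "\<And>y. R < norm y \<Longrightarrow> w0 y = 0" "1 - t \<le> (LINT y|lebesgue. w0 y)" "1 \<le> H" "p = 1 \<or> H = 1"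
    "AE y in lebesgue. \<forall>F. finite F \<longrightarrow> L * (\<Sum>k\<in>F. w0 (y - b *v lattice_vec k)) \<le> H"
proof -
  \<comment> \<open>Cutting off the support limits the number of overlapping translates, and cutting
    off the height bounds each of them. Together they bound the periodization even if that of
    \<open>w\<close> is unbounded.\<close>
  define v where "v = (\<lambda>(n::nat) y. if norm y \<le> real n \<and> w y \<le> real n then w y else 0)"
  have wm: "w \<in> borel_measurable lebesgue" using w_int(1) by simp
  have nm: "(norm :: real ^ 'n \<Rightarrow> real) \<in> borel_measurable lebesgue"
    by (intro measurable_completion) simp
  have vm: "v n \<in> borel_measurable lebesgue" for n
    unfolding v_def using wm nm by measurable
  have v: "0 \<le> v n y" "v n y \<le> w y" for n y
    using w_nonneg by (auto simp: v_def)
  have vint: "integrable lebesgue (v n)" for n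
    by (rule Bochner_Integration.integrable_bound[OF w_int(1) vm]) (use v w_nonneg in auto)
  have "(\<lambda>n. LINT y|lebesgue. v n y) \<longlonglongrightarrow> (LINT y|lebesgue. w y)"
  proof (rule integral_dominated_convergence[OF wm vm w_int(1)])
    show "AE y in lebesgue. (\<lambda>n. v n y) \<longlonglongrightarrow> w y"
    proof (intro AE_I2 tendsto_eventually)
      fix y
      obtain N where "max (norm y) (w y) \<le> real N" using real_arch_simple by blast
      then have "\<forall>n\<ge>N. v n y = w y" by (auto simp: v_def)
      then show "\<forall>\<^sub>F n in sequentially. v n y = w y"
        by (auto simp: eventually_sequentially)
    qed
    show "AE y in lebesgue. norm (v n y) \<le> w y" for n
      using v by (intro AE_I2) simp
  qed
  then have "\<forall>\<^sub>F n in sequentially. 1 - t < (LINT y|lebesgue. v n y)"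
    by (rule order_tendstoD(1)) (use t w_int(2) in simp)
  then obtain n where n: "1 - t < (LINT y|lebesgue. v n y)"
    by (meson eventually_sequentially order_refl)
  have supp: "v n y = 0" if "real n < norm y" for y
    using that by (simp add: v_def)
  show ?thesis
  proof (cases "p = 1")
    case True
    obtain N where N: "\<And>F y. finite F \<Longrightarrow> card {k \<in> F. norm (y - b *v lattice_vec k) \<le> real n} \<le> N"
      using lattice_overlap[OF b, of "real n"] by blast
    \<comment> \<open>At most \<open>N\<close> translates overlap and each is at most
      \<open>n\<close>; the maximum with 1 ensures \<open>1 \<le> H\<close>.\<close>
    have "L * (\<Sum>k\<in>F. v n (y - b *v lattice_vec k)) \<le> max 1 (L * (real N * real n))"
      if F: "finite F" for F y
    proof -
      let ?G = "{k \<in> F. norm (y - b *v lattice_vec k) \<le> real n}"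
      have "(\<Sum>k\<in>F. v n (y - b *v lattice_vec k)) = (\<Sum>k\<in>?G. v n (y - b *v lattice_vec k))"
        using F by (intro sum.mono_neutral_right) (auto simp: v_def split: if_splits)
      also have "\<dots> \<le> real (card ?G) * real n"
        using sum_bounded_above[of ?G "\<lambda>k. v n (y - b *v lattice_vec k)" "real n"] by (auto simp: v_def)
      also have "\<dots> \<le> real N * real n"
        using N[OF F, of y] by (intro mult_right_mono) auto
      finally show ?thesis
        using L_pos by (simp add: le_max_iff_disj)
    qed
    then show ?thesis
      using n True by (intro that[of "v n" "real n" "max 1 (L * (real N * real n))"] vint v supp) auto
  next
    case False
    then have per: "AE x in lebesgue. \<forall>F. finite F \<longrightarrow> L * (\<Sum>k\<in>F. w (x - b *v lattice_vec k)) \<le> 1"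
      using w_per by blast
    have "AE x in lebesgue. \<forall>F. finite F \<longrightarrow> L * (\<Sum>k\<in>F. v n (x - b *v lattice_vec k)) \<le> 1"
      using per
    proof eventually_elim
      case (elim x)
      have "L * (\<Sum>k\<in>F. v n (x - b *v lattice_vec k)) \<le> L * (\<Sum>k\<in>F. w (x - b *v lattice_vec k))" for F
        by (intro mult_left_mono sum_mono v) simp
      then show ?case using elim by (meson order_trans)
    qed
    then show ?thesis
      using n by (intro that[of "v n" "real n" 1] vint v supp) auto
  qed
qed

text \<open>With \<open>\<delta> = 1 / H\<close> the remainder splits almost everywhere into
  \<open>g1 + \<delta> * g2 - \<delta> * T1\<close>. Here \<open>g1\<close> is \<open>u\<close>
  damped by \<open>1 - \<delta> * h\<close>, where \<open>h\<close> is the periodization of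
  \<open>w0\<close> at scale \<open>A\<close> over the indices in \<open>F\<close>;
  \<open>g2\<close> is the error made in replacing \<open>u x\<close> by sampled values;
  \<open>T1\<close> is the sampled sum over the discarded part \<open>w - w0\<close>. The three
  terms of the bound belong to these functions in this order. For fixed \<open>u\<close>, the
  contributions of the oscillation vanish as \<open>e\<close> tends to 0.\<close>

lemma step_estimate:
  fixes A :: "real ^ 'n ^ 'n" and u :: "real ^ 'n \<Rightarrow> complex"
  assumes A: "invertible A" and u: "u \<in> Cc"
    and supp: "\<And>x. r < norm x \<Longrightarrow> u x = 0"
    and osc: "\<And>x y. norm (x - y) \<le> d \<Longrightarrow> norm (u x - u y) \<le> e"
    and osc_p: "\<And>x y. norm (x - y) \<le> d \<Longrightarrow> norm (norm (u x) powr p - norm (u y) powr p) \<le> e"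
    and e: "0 \<le> e" and d: "d \<le> 1" and \<tau>: "0 \<le> \<tau>" "\<tau> \<le> 1"
    and w0: "integrable lebesgue w0" "\<And>y. 0 \<le> w0 y" "\<And>y. w0 y \<le> w y"
      "\<And>y. R < norm y \<Longrightarrow> w0 y = 0" "1 - \<tau> powr p \<le> (LINT y|lebesgue. w0 y)"
    and H: "1 \<le> H"
      "AE y in lebesgue. \<forall>F. finite F \<longrightarrow> L * (\<Sum>k\<in>F. w0 (y - b *v lattice_vec k)) \<le> H"
    and small: "onorm ((*v) (matrix_inv A)) * R \<le> d"
      "onorm ((*v) (matrix_inv A)) * (onorm ((*v) b) * real CARD('n)) \<le> d"
  defines "U \<equiv> (LINT x|lebesgue. norm (u x) powr p)"
    and "m \<equiv> measure lebesgue (cball (0 :: real ^ 'n) (r + 1))"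
  shows "\<exists>c. finite {k. c k \<noteq> 0} \<and> cost c \<le> 1 / H * (U + e * m) powr (1 / p) \<and>
    Lp_norm p (\<lambda>x. u x - level A c x) \<le>
      (U * (1 - 1 / H * (1 - \<tau> powr p)) + 2 * (e * m)) powr (1 / p)
      + e * m powr (1 / p) + 1 / H * \<tau> * (U + e * m) powr (1 / p)"
proof -
  let ?s = "sample_point A b"
  let ?D = "\<bar>det A\<bar>"
  let ?B = "cball (0 :: real ^ 'n) (r + 1)"
  define \<delta> where "\<delta> = 1 / H"
  have \<delta>: "0 < \<delta>" "\<delta> \<le> 1" "\<delta> * H = 1" using H(1) by (auto simp: \<delta>_def)
  have D: "0 < ?D" using A by (simp add: invertible_det_nz)
  \<comment> \<open>The margin 1 beyond the support radius is the one that
    \<open>riemann_sum_error\<close> asks for.\<close>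
  define F where "F = {k. norm (?s k) \<le> r + 1}"
  have F: "finite F" unfolding F_def by (rule finite_sample_points[OF A b])
  define v where "v = (\<lambda>x. norm (u x) powr p)"
  have v: "v \<in> Cc" unfolding v_def using Cc_norm_powr[OF u] p by simp
  have v_supp: "v x = 0" if "r < norm x" for x using supp[OF that] by (simp add: v_def)
  have v_nonneg: "0 \<le> v x" for x by (simp add: v_def)
  have v_osc: "norm (v x - v y) \<le> e" if "norm (x - y) \<le> d" for x y
    using osc_p[OF that] by (simp add: v_def)
  have v_int: "integrable lebesgue v" by (rule Cc_integrable[OF v])
  have U: "U = (LINT x|lebesgue. v x)" by (simp add: U_def v_def)
  have U0: "0 \<le> U" unfolding U by (intro Bochner_Integration.integral_nonneg v_nonneg)
  have m0: "0 \<le> m" by (simp add: m_def)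
  \<comment> \<open>The Riemann sum for \<open>U\<close>: the cells around the sample points have
    volume \<open>L / \<bar>det A\<bar>\<close>.\<close>
  define Q where "Q = L / ?D * (\<Sum>k\<in>F. v (?s k))"
  have Q0: "0 \<le> Q" unfolding Q_def by (intro mult_nonneg_nonneg sum_nonneg v_nonneg) simp_all
  have UQ: "\<bar>U - Q\<bar> \<le> e * m"
    unfolding U Q_def m_def
    by (rule riemann_sum_error[OF A b v v_supp v_osc small(2) d e F]) (auto simp: F_def)
  then have QU: "Q powr (1 / p) \<le> (U + e * m) powr (1 / p)"
    using Q0 p by (intro powr_mono2) auto
  \<comment> \<open>The power of \<open>\<bar>det A\<bar>\<close> cancels the normalization of the
    affine system, the factor \<open>L\<close> turns the sum of translates into a periodization, and
    \<open>\<delta>\<close> is the damping factor.\<close>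
  define c where "c = (\<lambda>k. if k \<in> F then of_real (\<delta> * L * ?D powr (- (1 / p))) * u (?s k) else 0)"
  have c0: "c k = 0" if "k \<notin> F" for k using that by (simp add: c_def)
  have fin_c: "finite {k. c k \<noteq> 0}"
    by (rule finite_subset[OF _ F]) (use c0 in blast)

  \<comment> \<open>The coefficients carry \<open>L powr p\<close>, of which one factor
    \<open>L\<close> is absorbed in \<open>Q\<close>. The pth root of the remaining
    \<open>L powr (p - 1)\<close> cancels the weight in \<open>cost\<close>.\<close>
  have cost: "cost c = \<delta> * Q powr (1 / p)"
  proof -
    have "norm (c k) powr p = (\<delta> powr p * L powr p / ?D) * v (?s k)" if "k \<in> F" for k
    proof -
      have "norm (c k) = \<delta> * L * ?D powr (- (1 / p)) * norm (u (?s k))"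
        using that \<delta>(1) by (simp add: c_def norm_mult)
      then have "norm (c k) powr p = \<delta> powr p * L powr p * (?D powr (- (1 / p))) powr p * v (?s k)"
        by (simp add: powr_mult v_def)
      also have "(?D powr (- (1 / p))) powr p = 1 / ?D"
        unfolding powr_powr using p D by (simp add: powr_minus divide_inverse)
      finally show ?thesis by simp
    qed
    then have "(\<Sum>k\<in>F. norm (c k) powr p) = (\<Sum>k\<in>F. (\<delta> powr p * L powr p / ?D) * v (?s k))"
      by (intro sum.cong) auto
    also have "\<dots> = \<delta> powr p * L powr (p - 1) * Q"
      using L_pos by (simp add: Q_def sum_distrib_left powr_diff mult_ac)
    finally have s: "(\<Sum>k\<in>F. norm (c k) powr p) = \<delta> powr p * L powr (p - 1) * Q" .
    have "(\<delta> powr p * L powr (p - 1) * Q) powr (1 / p) = \<delta> * L powr (1 - 1 / p) * Q powr (1 / p)"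
    proof -
      have "(p - 1) * (1 / p) = 1 - 1 / p" using p by (simp add: field_simps)
      then have "(L powr (p - 1)) powr (1 / p) = L powr (1 - 1 / p)" by (simp only: powr_powr)
      moreover have "(\<delta> powr p) powr (1 / p) = \<delta>" using p \<delta>(1) by (simp add: powr_powr)
      ultimately show ?thesis by (simp add: powr_mult)
    qed
    moreover have "cost c = L powr (- (1 - 1 / p)) * (\<Sum>k\<in>F. norm (c k) powr p) powr (1 / p)"
      by (rule level_finite(3)[where c=c, OF A F c0])
    ultimately have "cost c = (L powr (- (1 - 1 / p)) * L powr (1 - 1 / p)) * (\<delta> * Q powr (1 / p))"
      unfolding s by (simp only: mult_ac)
    also have "L powr (- (1 - 1 / p)) * L powr (1 - 1 / p) = 1"
      unfolding powr_add[symmetric] using L_pos by simp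
    finally show ?thesis by simp
  qed

  let ?w = "\<lambda>k x. w (A *v x - b *v lattice_vec k)"
  let ?wt = "\<lambda>k x. w0 (A *v x - b *v lattice_vec k)"
  let ?wr = "\<lambda>k x. ?w k x - ?wt k x"
  define h where "h = (\<lambda>x. L * (\<Sum>k\<in>F. ?wt k x))"
  define g1 where "g1 = (\<lambda>x. (1 - \<delta> * h x) *\<^sub>R u x)"
  define T0 where "T0 = (\<lambda>x. L *\<^sub>R (\<Sum>k\<in>F. ?wt k x *\<^sub>R u (?s k)))"
  define g2 where "g2 = (\<lambda>x. h x *\<^sub>R u x - T0 x)"
  define T1 where "T1 = (\<lambda>x. L *\<^sub>R (\<Sum>k\<in>F. ?wr k x *\<^sub>R u (?s k)))"
  have iw: "integrable lebesgue (?w k)" "(LINT x|lebesgue. ?w k x) = 1 / ?D" for k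
    using translate_integral[OF A w_int(1) w_nonneg] w_int(2) by auto
  have iw0: "integrable lebesgue (?wt k)" "(LINT x|lebesgue. ?wt k x) = (LINT x|lebesgue. w0 x) / ?D" for k
    using translate_integral[OF A w0(1,2)] by auto
  have wm: "?w k \<in> borel_measurable lebesgue" "?wt k \<in> borel_measurable lebesgue" for k
    using iw(1) iw0(1) by (auto dest: borel_measurable_integrable)
  have um: "u \<in> borel_measurable lebesgue" by (rule Cc_measurable[OF u])
  have hm: "h \<in> borel_measurable lebesgue" unfolding h_def using wm by simp
  have T0m: "T0 \<in> borel_measurable lebesgue" unfolding T0_def using wm by simp
  have T1m: "T1 \<in> borel_measurable lebesgue" unfolding T1_def using wm by simp
  have g1m: "g1 \<in> borel_measurable lebesgue" unfolding g1_def using hm um by simp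
  have g2m: "g2 \<in> borel_measurable lebesgue" unfolding g2_def using hm um T0m by simp
  have hH: "AE x in lebesgue. h x \<le> H"
  proof -
    have "AE x in lebesgue. \<forall>F. finite F \<longrightarrow> L * (\<Sum>k\<in>F. ?wt k x) \<le> H"
      using AE_affine[OF A H(2), of 0] by simp
    then show ?thesis unfolding h_def using F by (auto elim!: eventually_mono)
  qed
  have h0: "0 \<le> h x" for x
    unfolding h_def by (intro mult_nonneg_nonneg sum_nonneg w0(2)) simp

  have vh: "integrable lebesgue (\<lambda>x. v x * h x)"
    and vh_le: "\<bar>(LINT x|lebesgue. v x * h x) - Q * (LINT x|lebesgue. w0 x)\<bar> \<le> e * H * m"
    unfolding h_def Q_def m_def
    using sampling_error_integral[where L=L and H=H, OF A v v_supp v_osc w0(1,2,4) small(1) d e F] hH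
    by (simp_all add: h_def)
  have g1: "g1 \<in> Lp_space p"
    "Lp_norm p g1 \<le> (U * (1 - \<delta> * (1 - \<tau> powr p)) + 2 * (e * m)) powr (1 / p)"
  proof -
    have int: "integrable lebesgue (\<lambda>x. v x - \<delta> * (v x * h x))"
      using v_int vh by simp
    \<comment> \<open>As \<open>1 - \<delta> * h x\<close> lies between 0 and 1, its pth power is at
      most itself. This makes the majorant linear in \<open>h\<close>, so its integral is accessible
      by sampling.\<close>
    have le: "AE x in lebesgue. norm (g1 x) powr p \<le> v x - \<delta> * (v x * h x)"
      using hH
    proof eventually_elim
      case (elim x)
      have "\<delta> * h x \<le> 1"
        using mult_left_mono[OF elim less_imp_le[OF \<delta>(1)]] \<delta>(3) by simp
      then have q: "0 \<le> 1 - \<delta> * h x" "1 - \<delta> * h x \<le> 1"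
        using h0[of x] \<delta>(1) by auto
      have "norm (g1 x) powr p = (1 - \<delta> * h x) powr p * v x"
        using q by (simp add: g1_def v_def powr_mult)
      also have "\<dots> \<le> (1 - \<delta> * h x) powr 1 * v x"
        using q p by (intro mult_right_mono powr_mono' v_nonneg) auto
      also have "\<dots> = v x - \<delta> * (v x * h x)"
        using q by (simp add: algebra_simps)
      finally show ?case .
    qed
    show "g1 \<in> Lp_space p" by (rule Lp_bound(1)[OF p g1m int le])
    have \<tau>p: "0 \<le> 1 - \<tau> powr p" "\<tau> powr p \<ge> 0"
      using \<tau> p powr_le_one_le[of \<tau> p] by (cases "\<tau> = 0"; simp)+
    have "(LINT x|lebesgue. v x - \<delta> * (v x * h x)) = U - \<delta> * (LINT x|lebesgue. v x * h x)"
      using v_int vh by (simp add: U)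
    \<comment> \<open>One error \<open>e * m\<close> stems from comparing \<open>U\<close> with the
      Riemann sum \<open>Q\<close>, the other from sampling against \<open>h\<close>; the factor
      \<open>H\<close> of the latter is compensated by \<open>\<delta>\<close>.\<close>
    also have "\<dots> \<le> U - \<delta> * ((U - e * m) * (1 - \<tau> powr p) - e * H * m)"
    proof -
      have "(U - e * m) * (1 - \<tau> powr p) \<le> Q * (1 - \<tau> powr p)"
        using UQ \<tau>p by (intro mult_right_mono) auto
      also have "\<dots> \<le> Q * (LINT x|lebesgue. w0 x)"
        using w0(5) Q0 by (intro mult_left_mono)
      finally have "(U - e * m) * (1 - \<tau> powr p) - e * H * m \<le> (LINT x|lebesgue. v x * h x)"
        using vh_le by linarith
      then show ?thesis using \<delta>(1) by simp
    qed
    also have "\<dots> = U * (1 - \<delta> * (1 - \<tau> powr p)) + \<delta> * (1 - \<tau> powr p) * (e * m) + (\<delta> * H) * (e * m)"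
      by (simp add: algebra_simps)
    also have "\<dots> \<le> U * (1 - \<delta> * (1 - \<tau> powr p)) + 1 * (e * m) + 1 * (e * m)"
      using \<tau>p \<delta> e m0 mult_le_one[of \<delta> "1 - \<tau> powr p"] by (intro add_mono mult_right_mono) auto
    finally have "(LINT x|lebesgue. v x - \<delta> * (v x * h x)) \<le> U * (1 - \<delta> * (1 - \<tau> powr p)) + 2 * (e * m)"
      by simp
    moreover have "0 \<le> (LINT x|lebesgue. v x - \<delta> * (v x * h x))"
      by (rule integral_nonneg_AE, rule eventually_mono[OF le]) (rule order_trans[OF powr_ge_zero])
    ultimately have "(LINT x|lebesgue. v x - \<delta> * (v x * h x)) powr (1 / p) \<le>
        (U * (1 - \<delta> * (1 - \<tau> powr p)) + 2 * (e * m)) powr (1 / p)"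
      using p by (intro powr_mono2) auto
    with Lp_bound(2)[OF p g1m int le]
    show "Lp_norm p g1 \<le> (U * (1 - \<delta> * (1 - \<tau> powr p)) + 2 * (e * m)) powr (1 / p)"
      by (rule order_trans)
  qed

  have g2: "g2 \<in> Lp_space p" "Lp_norm p g2 \<le> e * H * m powr (1 / p)"
  proof -
    have int: "integrable lebesgue (\<lambda>x. (e * H) powr p * indicat_real ?B x)"
      using lmeasurable_cball[of "0 :: real ^ 'n" "r + 1"]
      by (intro integrable_mult_right) (simp add: lmeasurable_iff_integrable)
    have le: "AE x in lebesgue. norm (g2 x) powr p \<le> (e * H) powr p * indicat_real ?B x"
      using hH
    proof eventually_elim
      case (elim x)
      have "g2 x = L *\<^sub>R ((\<Sum>k\<in>F. ?wt k x) *\<^sub>R u x - (\<Sum>k\<in>F. ?wt k x *\<^sub>R u (?s k)))"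
        by (simp add: g2_def h_def T0_def scaleR_diff_right)
      then have "norm (g2 x) = L * norm ((\<Sum>k\<in>F. ?wt k x) *\<^sub>R u x - (\<Sum>k\<in>F. ?wt k x *\<^sub>R u (?s k)))"
        by simp
      also have "\<dots> \<le> L * (e * (\<Sum>k\<in>F. ?wt k x) * indicat_real ?B x)"
        by (intro mult_left_mono sampling_error_pointwise[OF A supp osc w0(2,4) small(1) d]) auto
      also have "\<dots> = h x * (e * indicat_real ?B x)"
        by (simp add: h_def)
      also have "\<dots> \<le> H * (e * indicat_real ?B x)"
        using elim e by (intro mult_right_mono) auto
      finally have "norm (g2 x) powr p \<le> (H * (e * indicat_real ?B x)) powr p"
        using p by (intro powr_mono2) auto
      also have "\<dots> = (e * H) powr p * indicat_real ?B x"
        using p by (simp add: indicator_def mult.commute)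
      finally show ?case .
    qed
    show "g2 \<in> Lp_space p" by (rule Lp_bound(1)[OF p g2m int le])
    have i: "(LINT x|lebesgue. (e * H) powr p * indicat_real ?B x) = (e * H) powr p * m"
      by (simp add: m_def)
    have j: "((e * H) powr p * m) powr (1 / p) = e * H * m powr (1 / p)"
      unfolding powr_mult[of "(e * H) powr p" m] powr_powr using p e H(1) by simp
    show "Lp_norm p g2 \<le> e * H * m powr (1 / p)"
      using Lp_bound(2)[OF p g2m int le] unfolding i j .
  qed

  \<comment> \<open>Jensen's inequality with the weights \<open>w - w0\<close>, which inherit the
    periodization bound. Their integral is at most \<open>\<tau> powr p\<close>, and the pth root of
    this gives the factor \<open>\<tau>\<close>.\<close>
  have T1: "T1 \<in> Lp_space p" "Lp_norm p T1 \<le> \<tau> * Q powr (1 / p)"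
  proof -
    let ?G = "\<lambda>x. L * (\<Sum>k\<in>F. v (?s k) * ?wr k x)"
    have int: "integrable lebesgue ?G"
      using iw(1) iw0(1) by simp
    have w1_nonneg: "0 \<le> ?wr k x" for k x using w0(3) by simp
    have pt: "norm (T1 x) powr p \<le> ?G x"
      if "p = 1 \<or> (\<forall>F. finite F \<longrightarrow> L * (\<Sum>k\<in>F. ?w k x) \<le> 1)" for x
    proof -
      have "norm (T1 x) \<le> L * (\<Sum>k\<in>F. norm (u (?s k)) * ?wr k x)"
        unfolding T1_def norm_scaleR abs_abs using w1_nonneg
        by (intro mult_left_mono sum_norm_le) auto
      then have "norm (T1 x) powr p \<le> (L * (\<Sum>k\<in>F. norm (u (?s k)) * ?wr k x)) powr p"
        using p by (intro powr_mono2) auto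
      also have "\<dots> \<le> ?G x"
        unfolding v_def
      proof (rule powr_weighted_sum_le[OF p F L_pos w1_nonneg])
        have "L * (\<Sum>k\<in>F. ?wr k x) \<le> L * (\<Sum>k\<in>F. ?w k x)"
          using w0(2) by (intro mult_left_mono sum_mono) auto
        then show "p = 1 \<or> L * (\<Sum>k\<in>F. ?wr k x) \<le> 1"
          using that F by (meson order_trans)
      qed simp
      finally show ?thesis .
    qed
    have le: "AE x in lebesgue. norm (T1 x) powr p \<le> ?G x"
      using per_translates[OF A] pt by (auto elim: eventually_mono)
    show "T1 \<in> Lp_space p" by (rule Lp_bound(1)[OF p T1m int le])
    have "(LINT x|lebesgue. ?G x) = L * (\<Sum>k\<in>F. v (?s k) * (1 / ?D - (LINT x|lebesgue. w0 x) / ?D))"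
      using iw iw0 by simp
    also have "\<dots> = Q * (1 - (LINT x|lebesgue. w0 x))"
      by (simp add: Q_def sum_distrib_left sum_distrib_right diff_divide_distrib[symmetric] mult.assoc)
    also have "\<dots> \<le> Q * \<tau> powr p"
      using w0(5) Q0 by (intro mult_left_mono) auto
    finally have "(LINT x|lebesgue. ?G x) powr (1 / p) \<le> (Q * \<tau> powr p) powr (1 / p)"
      using p w1_nonneg by (intro powr_mono2)
        (auto intro!: Bochner_Integration.integral_nonneg mult_nonneg_nonneg sum_nonneg v_nonneg)
    also have "\<dots> = \<tau> * Q powr (1 / p)"
      unfolding powr_mult powr_powr using p \<tau> by simp
    finally show "Lp_norm p T1 \<le> \<tau> * Q powr (1 / p)"
      using Lp_bound(2)[OF p T1m int le] by (rule order_trans[rotated])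
  qed

  have level_eq: "AE x in lebesgue. (g1 x + of_real \<delta> * g2 x) - of_real \<delta> * T1 x = u x - level A c x"
    using psi_translates[OF A]
  proof eventually_elim
    case (elim x)
    have "c k * (of_real (?D powr (1 / p)) * of_real (?w k x)) = of_real (\<delta> * L) * (?w k x *\<^sub>R u (?s k))"
      if "k \<in> F" for k
    proof -
      have "?D powr (- (1 / p)) * ?D powr (1 / p) = 1"
        using D by (simp add: powr_add[symmetric])
      then have one: "of_real (?D powr (- (1 / p))) * of_real (?D powr (1 / p)) = (1 :: complex)"
        by (metis of_real_1 of_real_mult)
      have "c k * (of_real (?D powr (1 / p)) * of_real (?w k x)) =
          (of_real (?D powr (- (1 / p))) * of_real (?D powr (1 / p))) * (of_real (\<delta> * L) * (of_real (?w k x) * u (?s k)))"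
        using that by (simp add: c_def mult_ac)
      then show ?thesis by (simp add: one scaleR_conv_of_real)
    qed
    then have "level A c x = (\<Sum>k\<in>F. of_real (\<delta> * L) * (?w k x *\<^sub>R u (?s k)))"
      using elim by (subst level_finite(1)[where c=c, OF A F c0]) (auto intro!: sum.cong)
    also have "\<dots> = of_real \<delta> * (L *\<^sub>R (\<Sum>k\<in>F. ?w k x *\<^sub>R u (?s k)))"
      by (simp add: sum_distrib_left scaleR_conv_of_real mult_ac)
    also have "L *\<^sub>R (\<Sum>k\<in>F. ?w k x *\<^sub>R u (?s k)) = T0 x + T1 x"
      by (simp add: T0_def T1_def scaleR_add_right[symmetric] sum.distrib[symmetric] scaleR_add_left[symmetric]
          del: scaleR_add_right scaleR_add_left)
    finally show ?case
      by (simp add: g1_def g2_def scaleR_conv_of_real algebra_simps)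
  qed
  have lev: "level A c \<in> Lp_space p" by (rule level_finite(2)[where c=c, OF A F c0])
  have \<delta>g2: "(\<lambda>x. of_real \<delta> * g2 x) \<in> Lp_space p" "Lp_norm p (\<lambda>x. of_real \<delta> * g2 x) = \<delta> * Lp_norm p g2"
    using Lp_scale[OF p g2(1), of "of_real \<delta>"] \<delta>(1) by simp_all
  have \<delta>T1: "(\<lambda>x. of_real \<delta> * T1 x) \<in> Lp_space p" "Lp_norm p (\<lambda>x. of_real \<delta> * T1 x) = \<delta> * Lp_norm p T1"
    using Lp_scale[OF p T1(1), of "of_real \<delta>"] \<delta>(1) by simp_all
  have "Lp_norm p (\<lambda>x. u x - level A c x) = Lp_norm p (\<lambda>x. (g1 x + of_real \<delta> * g2 x) - of_real \<delta> * T1 x)"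
    using um Lp_spaceD(1)[OF lev]
    by (intro Lp_cong_AE(2)[OF _ _ level_eq] Lp_diff(1) Lp_add(1) p g1(1) \<delta>g2(1) \<delta>T1(1)) simp
  also have "\<dots> \<le> (Lp_norm p g1 + \<delta> * Lp_norm p g2) + \<delta> * Lp_norm p T1"
    using Lp_diff(2)[OF p Lp_add(1)[OF p g1(1) \<delta>g2(1)] \<delta>T1(1)] Lp_add(2)[OF p g1(1) \<delta>g2(1)] \<delta>g2(2) \<delta>T1(2)
    by linarith
  also have "\<dots> \<le> ((U * (1 - \<delta> * (1 - \<tau> powr p)) + 2 * (e * m)) powr (1 / p) + \<delta> * (e * H * m powr (1 / p)))
      + \<delta> * (\<tau> * (U + e * m) powr (1 / p))"
    using g1(2) g2(2) T1(2) \<delta>(1) mult_left_mono[OF QU \<tau>(1)]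
    by (intro add_mono mult_left_mono) auto
  also have "\<delta> * (e * H * m powr (1 / p)) = (\<delta> * H) * (e * m powr (1 / p))" by simp
  finally have "Lp_norm p (\<lambda>x. u x - level A c x) \<le>
      (U * (1 - 1 / H * (1 - \<tau> powr p)) + 2 * (e * m)) powr (1 / p)
      + e * m powr (1 / p) + 1 / H * \<tau> * (U + e * m) powr (1 / p)"
    unfolding \<delta>(3) by (simp add: \<delta>_def)
  moreover have "cost c \<le> 1 / H * (U + e * m) powr (1 / p)"
    unfolding cost using mult_left_mono[OF QU less_imp_le[OF \<delta>(1)]] by (simp add: \<delta>_def)
  ultimately show ?thesis using fin_c by blast
qed

end

section \<open>Greedy synthesis\<close>

text \<open>The limit is taken from the right so that the base stays nonnegative, which matters when
  \<open>x = 0\<close>.\<close>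

lemma tendsto_affine_powr:
  fixes x y s :: real
  assumes "0 \<le> x" "0 \<le> y" "0 < s"
  shows "((\<lambda>e. (x + e * y) powr s) \<longlongrightarrow> x powr s) (at_right 0)"
proof (rule tendsto_powr'[OF _ tendsto_const])
  have "((\<lambda>e. x + e * y) \<longlongrightarrow> x + 0 * y) (at_right 0)"
    by (intro tendsto_intros)
  then show "((\<lambda>e. x + e * y) \<longlongrightarrow> x) (at_right 0)" by simp
  have "\<forall>\<^sub>F e in at_right 0. 0 \<le> x + e * y"
    using eventually_at_right_less[of "0 :: real"]
    by (rule eventually_mono) (use assms in auto)
  then show "x \<noteq> 0 \<or> 0 < s \<and> (\<forall>\<^sub>F e in at_right 0. 0 \<le> x + e * y)"
    using assms(3) by blast
qed

context affine_synthesis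
begin

lemma level_zero: "level A (\<lambda>k. 0) = (\<lambda>x. 0)" "cost (\<lambda>k. 0) = 0"
  using p by (auto simp: level_def cost_def)

text \<open>The factor \<delta> depends on \<open>\<tau>\<close> through the truncation but not on
  \<open>g\<close> or \<open>J\<close>, which makes the contraction uniform over all remainders. For
  given \<open>g\<close>, first a function \<open>u\<close> in \<open>Cc\<close> near
  \<open>g\<close> is fixed, then the oscillation \<open>e\<close>, then the radius
  \<open>d\<close>, and finally a level \<open>j\<close> fine enough for \<open>d\<close>.\<close>

lemma contraction_step:
  assumes a: "\<And>j. j > 0 \<Longrightarrow> invertible (a j)" "expanding a" and \<tau>: "0 < \<tau>" "\<tau> \<le> 1"
  obtains \<delta> where "0 < \<delta>" "\<delta> \<le> 1"
    "\<And>g J. g \<in> Lp_space p \<Longrightarrow> \<exists>j>J. \<exists>c. finite {k. c k \<noteq> 0} \<and>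
      cost c \<le> \<delta> * (1 + 2 * \<tau>) * Lp_norm p g \<and>
      Lp_norm p (\<lambda>x. g x - level (a j) c x) \<le> (1 - \<delta> * (1 - 7 * \<tau>)) * Lp_norm p g"
proof -
  have tp: "0 < \<tau> powr p" using \<tau> by simp
  obtain w0 R H where w0: "integrable lebesgue w0" "\<And>y. 0 \<le> w0 y" "\<And>y. w0 y \<le> w y"
      "\<And>y. R < norm y \<Longrightarrow> w0 y = 0" "1 - \<tau> powr p \<le> (LINT y|lebesgue. w0 y)"
    and H: "1 \<le> H" "p = 1 \<or> H = 1"
      "AE y in lebesgue. \<forall>F. finite F \<longrightarrow> L * (\<Sum>k\<in>F. w0 (y - b *v lattice_vec k)) \<le> H"
    using truncation[OF tp] by blast
  define \<delta> where "\<delta> = 1 / H"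
  have \<delta>: "0 < \<delta>" "\<delta> \<le> 1" using H(1) by (auto simp: \<delta>_def)
  define \<kappa> where "\<kappa> = 1 - \<delta> * (1 - \<tau> powr p)"
  have tp1: "\<tau> powr p \<le> 1"
    using \<tau> p by (simp add: powr_le1)
  \<comment> \<open>For \<open>p = 1\<close> the second claim is an equality; for
    \<open>p > 1\<close> there is no damping, and \<kappa> is \<open>\<tau> powr p\<close>.\<close>
  have \<kappa>: "0 \<le> \<kappa>" "\<kappa> powr (1 / p) \<le> 1 - \<delta> + \<delta> * \<tau>"
  proof -
    have "\<delta> * (1 - \<tau> powr p) \<le> 1 * 1"
      using \<delta> tp tp1 by (intro mult_mono) auto
    then show k0: "0 \<le> \<kappa>" by (simp add: \<kappa>_def)
    show "\<kappa> powr (1 / p) \<le> 1 - \<delta> + \<delta> * \<tau>"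
    proof (cases "p = 1")
      case True
      then show ?thesis using k0 \<tau> by (simp add: \<kappa>_def algebra_simps)
    next
      case False
      then have "\<delta> = 1" using H(2) by (simp add: \<delta>_def)
      then have "\<kappa> powr (1 / p) = (\<tau> powr p) powr (1 / p)" by (simp add: \<kappa>_def)
      also have "\<dots> = \<tau>" unfolding powr_powr using p \<tau> by simp
      finally show ?thesis using \<open>\<delta> = 1\<close> by simp
    qed
  qed
  have "\<exists>j>J. \<exists>c. finite {k. c k \<noteq> 0} \<and> cost c \<le> \<delta> * (1 + 2 * \<tau>) * Lp_norm p g \<and>
      Lp_norm p (\<lambda>x. g x - level (a j) c x) \<le> (1 - \<delta> * (1 - 7 * \<tau>)) * Lp_norm p g"
    if g: "g \<in> Lp_space p" for g and J :: nat
  proof (cases "Lp_norm p g = 0")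
    case True
    then show ?thesis
      using p by (intro exI[of _ "Suc J"] conjI exI[of _ "\<lambda>k. 0"]) (simp_all add: level_zero)
  next
    case False
    define n where "n = Lp_norm p g"
    have n: "0 < n" using False Lp_norm_nonneg[of p g] by (simp add: n_def less_le)
    have s: "0 < \<delta> * \<tau> * n" using \<delta> \<tau> n by simp
    obtain u where u: "u \<in> Cc" "Lp_norm p (\<lambda>x. g x - u x) < \<delta> * \<tau> * n"
      using Cc_closureE[OF Cc_dense[OF p g] s] by blast
    have uL: "u \<in> Lp_space p" by (rule Cc_Lp[OF u(1) p])
    define N where "N = Lp_norm p u"
    have N: "0 \<le> N" "N \<le> (1 + \<delta> * \<tau>) * n"
    proof -
      have "N \<le> Lp_norm p (\<lambda>x. u x - g x) + n"
        using Lp_add(2)[OF p Lp_diff(1)[OF p uL g] g] by (simp add: N_def n_def)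
      then show "N \<le> (1 + \<delta> * \<tau>) * n"
        using u(2) Lp_norm_minus_commute[of p u g] by (simp add: algebra_simps)
    qed (simp add: N_def)
    define U where "U = (LINT x|lebesgue. norm (u x) powr p)"
    have U: "0 \<le> U" by (auto simp: U_def intro!: Bochner_Integration.integral_nonneg)
    have UN: "U powr (1 / p) = N" by (simp add: U_def N_def Lp_norm_def)
    obtain r where r: "0 < r" "\<And>x. r < norm x \<Longrightarrow> u x = 0"
      using Cc_support[OF u(1)] by blast
    define m where "m = measure lebesgue (cball (0 :: real ^ 'n) (r + 1))"
    have m: "0 \<le> m" by (simp add: m_def)
    let ?cst = "\<lambda>e. \<delta> * (U + e * m) powr (1 / p)"
    let ?res = "\<lambda>e. (U * \<kappa> + 2 * (e * m)) powr (1 / p) + e * m powr (1 / p) + \<delta> * \<tau> * (U + e * m) powr (1 / p)"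
    have pos: "\<forall>\<^sub>F e in at_right (0::real). 0 < e"
      by (rule eventually_at_right_less)
    have l1: "((\<lambda>e. (U + e * m) powr (1 / p)) \<longlongrightarrow> U powr (1 / p)) (at_right 0)"
      using p U m by (intro tendsto_affine_powr) auto
    have l2: "((\<lambda>e. (U * \<kappa> + 2 * (e * m)) powr (1 / p)) \<longlongrightarrow> (U * \<kappa>) powr (1 / p)) (at_right 0)"
      using tendsto_affine_powr[of "U * \<kappa>" "2 * m" "1 / p"] p U m \<kappa> by (simp add: mult_ac)
    have "(?cst \<longlongrightarrow> \<delta> * U powr (1 / p)) (at_right 0)"
      by (intro tendsto_intros l1)
    then have "(?cst \<longlongrightarrow> \<delta> * N) (at_right 0)"
      by (simp add: UN)
    then have e1: "\<forall>\<^sub>F e in at_right 0. ?cst e < \<delta> * N + \<delta> * \<tau> * n"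
      by (rule order_tendstoD(2)) (use s in simp)
    have "(?res \<longlongrightarrow> (U * \<kappa>) powr (1 / p) + 0 * m powr (1 / p) + \<delta> * \<tau> * U powr (1 / p)) (at_right 0)"
      by (intro tendsto_intros l1 l2)
    then have "(?res \<longlongrightarrow> N * \<kappa> powr (1 / p) + \<delta> * \<tau> * N) (at_right 0)"
      by (simp add: UN powr_mult)
    then have e2: "\<forall>\<^sub>F e in at_right 0. ?res e < N * (1 - \<delta> + 2 * (\<delta> * \<tau>)) + \<delta> * \<tau> * n"
    proof (rule order_tendstoD(2))
      have "N * \<kappa> powr (1 / p) \<le> N * (1 - \<delta> + \<delta> * \<tau>)"
        using \<kappa>(2) N(1) by (intro mult_left_mono)
      then show "N * \<kappa> powr (1 / p) + \<delta> * \<tau> * N < N * (1 - \<delta> + 2 * (\<delta> * \<tau>)) + \<delta> * \<tau> * n"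
        using s by (simp add: algebra_simps)
    qed
    \<comment> \<open>Both bounds hold strictly in the limit as \<open>e\<close> tends to 0, hence
      also for some positive \<open>e\<close>.\<close>
    obtain e where e: "0 < e" "?cst e < \<delta> * N + \<delta> * \<tau> * n"
        "?res e < N * (1 - \<delta> + 2 * (\<delta> * \<tau>)) + \<delta> * \<tau> * n"
      using eventually_happens[OF eventually_conj[OF pos eventually_conj[OF e1 e2]]] by auto
    obtain d1 where d1: "0 < d1" "\<And>x y. norm (x - y) \<le> d1 \<Longrightarrow> norm (u x - u y) \<le> e"
      using Cc_uniform[OF u(1) e(1)] by blast
    have up: "(\<lambda>x. norm (u x) powr p) \<in> Cc" using Cc_norm_powr[OF u(1)] p by simp
    obtain d2 where d2: "0 < d2"
        "\<And>x y. norm (x - y) \<le> d2 \<Longrightarrow> norm (norm (u x) powr p - norm (u y) powr p) \<le> e"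
      using Cc_uniform[OF up e(1)] by blast
    define d where "d = min 1 (min d1 d2)"
    have d: "0 < d" "d \<le> 1" "d \<le> d1" "d \<le> d2" using d1(1) d2(1) by (auto simp: d_def)
    let ?o = "\<lambda>j. onorm ((*v) (matrix_inv (a j)))"
    have "(\<lambda>j. ?o j * R) \<longlonglongrightarrow> 0 * R"
      using a(2) unfolding expanding_def by (intro tendsto_intros)
    then have f1: "\<forall>\<^sub>F j in sequentially. ?o j * R < d"
      by (rule order_tendstoD(2)) (use d in simp)
    have "(\<lambda>j. ?o j * (onorm ((*v) b) * real CARD('n))) \<longlonglongrightarrow> 0 * (onorm ((*v) b) * real CARD('n))"
      using a(2) unfolding expanding_def by (intro tendsto_intros)
    then have f2: "\<forall>\<^sub>F j in sequentially. ?o j * (onorm ((*v) b) * real CARD('n)) < d"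
      by (rule order_tendstoD(2)) (use d in simp)
    obtain j where j: "J < j" "?o j * R < d" "?o j * (onorm ((*v) b) * real CARD('n)) < d"
      using eventually_happens[OF eventually_conj[OF eventually_gt_at_top[of J] eventually_conj[OF f1 f2]]] by auto
    have A: "invertible (a j)" using a(1) j(1) by simp
    have o1: "norm (u x - u y) \<le> e" if "norm (x - y) \<le> d" for x y
      using d1(2) that d(3) by (meson order_trans)
    have o2: "norm (norm (u x) powr p - norm (u y) powr p) \<le> e" if "norm (x - y) \<le> d" for x y
      using d2(2) that d(4) by (meson order_trans)
    obtain c where c: "finite {k. c k \<noteq> 0}" "cost c \<le> ?cst e"
        "Lp_norm p (\<lambda>x. u x - level (a j) c x) \<le> ?res e"
      using step_estimate[where r=r, OF A u(1) r(2) o1 o2 less_imp_le[OF e(1)] d(2) less_imp_le[OF \<tau>(1)] \<tau>(2)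
          w0 H(1,3) less_imp_le[OF j(2)] less_imp_le[OF j(3)]]
      unfolding \<delta>_def[symmetric] \<kappa>_def[symmetric] U_def[symmetric] m_def[symmetric]
      by blast
    have fin: "finite {k. c k \<noteq> 0}" "\<And>k. k \<notin> {k. c k \<noteq> 0} \<Longrightarrow> c k = 0" using c(1) by auto
    have lev: "level (a j) c \<in> Lp_space p" by (rule level_finite(2)[OF A fin])
    have t1: "\<delta> * \<tau> \<le> \<tau>" using \<delta> \<tau> by (simp add: mult_left_le_one_le)
    have "cost c \<le> \<delta> * ((1 + \<delta> * \<tau>) * n) + \<delta> * \<tau> * n"
      using c(2) e(2) mult_left_mono[OF N(2), of \<delta>] \<delta> by linarith
    also have "\<dots> = \<delta> * (n * (1 + \<delta> * \<tau> + \<tau>))" by (simp add: algebra_simps)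
    also have "\<dots> \<le> \<delta> * (n * (1 + \<tau> + \<tau>))"
      using t1 \<delta> n by (intro mult_left_mono add_mono) auto
    finally have cost: "cost c \<le> \<delta> * (1 + 2 * \<tau>) * n" by (simp add: algebra_simps)
    \<comment> \<open>The coefficient 7 is 1 from approximating \<open>g\<close> by
      \<open>u\<close>, 2 + 3 from the bound on \<open>N\<close> times the contraction factor, and 1
      from the slack in the choice of \<open>e\<close>.\<close>
    have "Lp_norm p (\<lambda>x. g x - level (a j) c x) \<le> Lp_norm p (\<lambda>x. g x - u x) + Lp_norm p (\<lambda>x. u x - level (a j) c x)"
      by (rule Lp_norm_triangle[OF p g uL lev])
    also have "\<dots> \<le> \<delta> * \<tau> * n + (N * (1 - \<delta> + 2 * (\<delta> * \<tau>)) + \<delta> * \<tau> * n)"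
      using u(2) c(3) e(3) by linarith
    also have "N * (1 - \<delta> + 2 * (\<delta> * \<tau>)) \<le> (1 + \<delta> * \<tau>) * n * (1 - \<delta> + 2 * (\<delta> * \<tau>))"
      using N(2) \<delta> \<tau> by (intro mult_right_mono) auto
    also have "(1 + \<delta> * \<tau>) * n * (1 - \<delta> + 2 * (\<delta> * \<tau>)) =
        n * (1 - \<delta> + 2 * (\<delta> * \<tau>)) + (\<delta> * \<tau> * n) * (1 - \<delta> + 2 * (\<delta> * \<tau>))"
      by (simp add: algebra_simps)
    also have "(\<delta> * \<tau> * n) * (1 - \<delta> + 2 * (\<delta> * \<tau>)) \<le> (\<delta> * \<tau> * n) * 3"
    proof (rule mult_left_mono)
      show "1 - \<delta> + 2 * (\<delta> * \<tau>) \<le> 3" using t1 \<tau>(2) \<delta>(1) by linarith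
    qed (use s in simp)
    finally have "Lp_norm p (\<lambda>x. g x - level (a j) c x) \<le> (1 - \<delta> * (1 - 7 * \<tau>)) * n"
      by (simp add: algebra_simps)
    then show ?thesis
      using j(1) c(1) cost unfolding n_def by blast
  qed
  then show ?thesis using that \<delta> by blast
qed

lemma synthesis_level_eq: "synthesis_level p a b \<psi> C j = level (a j) (C j)"
  by (simp add: synthesis_level_def affine_system_def level_def fun_eq_iff)

text \<open>The bound on the partial sums is uniform in the number of levels, so it survives the
  limit in the norm.\<close>

lemma synthesis_norm_ge:
  assumes a: "\<And>j. j > 0 \<Longrightarrow> invertible (a j)"
    and C: "C \<in> l1lp_space p" and f: "is_synthesis p a b \<psi> C f"
  shows "Lp_norm p f \<le> L powr (- (1 - 1 / p)) * l1lp_norm p C"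
proof -
  let ?S = "\<lambda>N x. \<Sum>j\<in>{0<..N}. synthesis_level p a b \<psi> C j x"
  let ?q = "\<lambda>j. (\<Sum>\<^sub>\<infinity>k. norm (C j k) powr p) powr (1 / p)"
  let ?K = "L powr (- (1 - 1 / p))"
  have lev: "synthesis_level p a b \<psi> C j \<in> Lp_space p" if "j > 0" for j
    using f that by (simp add: is_synthesis_def)
  have fL: "f \<in> Lp_space p" using f by (simp add: is_synthesis_def)
  have S: "?S N \<in> Lp_space p" "Lp_norm p (?S N) \<le> ?K * l1lp_norm p C" for N
  proof -
    have sum: "?S N \<in> Lp_space p \<and> Lp_norm p (?S N) \<le> (\<Sum>j\<in>{0<..N}. Lp_norm p (synthesis_level p a b \<psi> C j))"
      by (rule Lp_sum[OF p]) (auto intro: lev)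
    then show "?S N \<in> Lp_space p" ..
    have "(\<Sum>j\<in>{0<..N}. Lp_norm p (synthesis_level p a b \<psi> C j)) \<le> (\<Sum>j\<in>{0<..N}. ?K * ?q j)"
    proof (rule sum_mono)
      fix j assume "j \<in> {0<..N}"
      then have j: "j > 0" by simp
      have "Lp_norm p (level (a j) (C j)) \<le> cost (C j)"
        using C j Lp_spaceD(1)[OF lev[OF j]]
        by (intro level_bound a) (auto simp: l1lp_space_def synthesis_level_eq)
      then show "Lp_norm p (synthesis_level p a b \<psi> C j) \<le> ?K * ?q j"
        by (simp add: synthesis_level_eq cost_def)
    qed
    also have "\<dots> = ?K * (\<Sum>j\<in>{0<..N}. ?q j)" by (simp add: sum_distrib_left)
    also have "\<dots> \<le> ?K * l1lp_norm p C"
      unfolding l1lp_norm_def using C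
      by (intro mult_left_mono finite_sum_le_infsum) (auto simp: l1lp_space_def)
    finally show "Lp_norm p (?S N) \<le> ?K * l1lp_norm p C" using sum by linarith
  qed
  have "(\<lambda>N. Lp_norm p (\<lambda>x. f x - ?S N x) + ?K * l1lp_norm p C) \<longlonglongrightarrow> 0 + ?K * l1lp_norm p C"
    using f unfolding is_synthesis_def by (intro tendsto_intros) auto
  moreover have "Lp_norm p f \<le> Lp_norm p (\<lambda>x. f x - ?S N x) + ?K * l1lp_norm p C" for N
    using Lp_add(2)[OF p Lp_diff(1)[OF p fL S(1)] S(1), of N N] S(2)[of N] by simp
  ultimately have "Lp_norm p f \<le> 0 + ?K * l1lp_norm p C"
    by (intro LIMSEQ_le_const) auto
  then show ?thesis by simp
qed

text \<open>Greedy construction: each nontrivial level pays at most \<kappa> times the amount by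
  which it lowers the norm of the remainder. The payments telescope, and as good levels exist
  arbitrarily far out, the remainder tends to 0.\<close>

lemma synthesis_exists:
  assumes a: "\<And>j. j > 0 \<Longrightarrow> invertible (a j)" "expanding a"
    and f: "f \<in> Lp_space p" and \<kappa>: "1 < \<kappa>"
  obtains C where "C \<in> l1lp_space p" "is_synthesis p a b \<psi> C f"
    "L powr (- (1 - 1 / p)) * l1lp_norm p C \<le> \<kappa> * Lp_norm p f"
proof -
  \<comment> \<open>This solves \<open>1 + 2 * \<tau> = \<kappa> * (1 - 7 * \<tau>)\<close>, so that
    the cost in \<open>contraction_step\<close> is at most \<kappa> times the decrease of the
    norm.\<close>
  define \<tau> where "\<tau> = (\<kappa> - 1) / (2 + 7 * \<kappa>)"
  have \<tau>: "0 < \<tau>" "7 * \<tau> < 1" "1 + 2 * \<tau> = \<kappa> * (1 - 7 * \<tau>)"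
    using \<kappa> by (auto simp: \<tau>_def field_simps)
  obtain \<delta> where \<delta>: "0 < \<delta>" "\<delta> \<le> 1" and step:
    "\<And>g J. g \<in> Lp_space p \<Longrightarrow> \<exists>j>J. \<exists>c. finite {k. c k \<noteq> 0} \<and>
      cost c \<le> \<delta> * (1 + 2 * \<tau>) * Lp_norm p g \<and>
      Lp_norm p (\<lambda>x. g x - level (a j) c x) \<le> (1 - \<delta> * (1 - 7 * \<tau>)) * Lp_norm p g"
    by (rule contraction_step[OF a \<tau>(1)]) (use \<tau> in \<open>auto 0 0\<close>)
  define \<theta> where "\<theta> = 1 - \<delta> * (1 - 7 * \<tau>)"
  have \<theta>: "0 \<le> \<theta>" "\<theta> < 1"
  proof -
    have "\<delta> * (1 - 7 * \<tau>) \<le> 1 * 1" using \<delta> \<tau> by (intro mult_mono) auto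
    then show "0 \<le> \<theta>" by (simp add: \<theta>_def)
    show "\<theta> < 1" using \<delta> \<tau> by (simp add: \<theta>_def)
  qed
  define good where "good = (\<lambda>j g c. finite {k. c k \<noteq> 0} \<and>
    cost c \<le> \<kappa> * (Lp_norm p g - Lp_norm p (\<lambda>x. g x - level (a j) c x)) \<and>
    Lp_norm p (\<lambda>x. g x - level (a j) c x) \<le> \<theta> * Lp_norm p g)"
  have good_ex: "\<exists>j>J. \<exists>c. good j g c" if g: "g \<in> Lp_space p" for g J
  proof -
    obtain j c where jc: "J < j" "finite {k. c k \<noteq> 0}" "cost c \<le> \<delta> * (1 + 2 * \<tau>) * Lp_norm p g"
        "Lp_norm p (\<lambda>x. g x - level (a j) c x) \<le> \<theta> * Lp_norm p g"
      using step[OF g] unfolding \<theta>_def by blast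
    have "cost c \<le> \<kappa> * (Lp_norm p g - \<theta> * Lp_norm p g)"
      using jc(3) unfolding \<tau>(3) by (simp add: \<theta>_def algebra_simps)
    also have "\<dots> \<le> \<kappa> * (Lp_norm p g - Lp_norm p (\<lambda>x. g x - level (a j) c x))"
      using jc(4) \<kappa> by (intro mult_left_mono) auto
    finally show ?thesis using jc unfolding good_def by blast
  qed
  \<comment> \<open>All levels are visited in order, instead of extracting a sequence of suitable
    ones; a level without good coefficients gets the zero sequence.\<close>
  define pick where "pick = (\<lambda>j g. if \<exists>c. good j g c then SOME c. good j g c else (\<lambda>k. 0))"
  have pick: "good j g (pick j g)" if "\<exists>c. good j g c" for j g
    using someI_ex[OF that] that by (simp add: pick_def)
  \<comment> \<open>\<open>res n\<close> is the remainder after levels 1 to \<open>n\<close>, so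
    level \<open>Suc n\<close> is chosen from \<open>res n\<close> and level 0 is skipped.\<close>
  define res where "res = rec_nat f (\<lambda>n g x. g x - level (a (Suc n)) (pick (Suc n) g) x)"
  have res: "res 0 = f" "res (Suc n) = (\<lambda>x. res n x - level (a (Suc n)) (pick (Suc n) (res n)) x)" for n
    by (simp_all add: res_def)
  \<comment> \<open>The cost estimate telescopes over all levels, since a level without a good choice contributes
    nothing and leaves the remainder unchanged.\<close>
  define C where "C = (\<lambda>j. pick j (res (j - 1)))"
  have C_fin: "finite {k. C j k \<noteq> 0}" for j
    using pick[of j "res (j - 1)"] by (cases "\<exists>c. good j (res (j - 1)) c") (auto simp: C_def good_def pick_def)
  have C_lev: "level (a j) (C j) \<in> Lp_space p" if "j > 0" for j
    by (rule level_finite(2)[OF a(1)[OF that] C_fin[of j]]) simp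
  have res_Lp: "res n \<in> Lp_space p" for n
  proof (induction n)
    case (Suc n)
    then show ?case
      using Lp_diff(1)[OF p Suc C_lev[of "Suc n"]] by (simp add: res C_def)
  qed (simp add: res f)
  have res_good: "good (Suc n) (res n) (C (Suc n)) \<or> C (Suc n) = (\<lambda>k. 0)" for n
    using pick[of "Suc n" "res n"] by (auto simp: C_def pick_def)
  have res_Suc: "res (Suc n) = (\<lambda>x. res n x - level (a (Suc n)) (C (Suc n)) x)" for n
    by (simp add: res C_def)
  have C_cost: "cost (C (Suc n)) \<le> \<kappa> * (Lp_norm p (res n) - Lp_norm p (res (Suc n)))" for n
    using res_good[of n]
  proof
    assume "C (Suc n) = (\<lambda>k. 0)"
    then show ?thesis by (simp add: res_Suc level_zero)
  qed (simp add: good_def res_Suc)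
  have res_mono: "Lp_norm p (res (Suc n)) \<le> Lp_norm p (res n)" for n
  proof -
    have "0 \<le> \<kappa> * (Lp_norm p (res n) - Lp_norm p (res (Suc n)))"
      using C_cost[of n] cost_nonneg[of "C (Suc n)"] by linarith
    then show ?thesis using \<kappa> by (simp add: zero_le_mult_iff)
  qed
  have res_anti: "Lp_norm p (res m) \<le> Lp_norm p (res n)" if "n \<le> m" for n m
    using lift_Suc_antimono_le[of "\<lambda>n. Lp_norm p (res n)", OF res_mono that] .
  \<comment> \<open>A level \<open>j\<close> beyond \<open>n\<close> is good for
    \<open>res n\<close>, but the remainder may change before \<open>j\<close> is reached. If so,
    the first change is a good choice at \<open>res n\<close> and already contracts by \<theta>, and
    later steps do not increase the norm. If not, level \<open>j\<close> still meets
    \<open>res n\<close> and a good choice is made there.\<close>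
  have shrink: "\<exists>m. Lp_norm p (res m) \<le> \<theta> * Lp_norm p (res n)" for n
  proof -
    obtain j c where j: "n < j" "good j (res n) c" using good_ex[OF res_Lp[of n]] by blast
    have dich: "res i = res n \<or> Lp_norm p (res i) \<le> \<theta> * Lp_norm p (res n)" if "n \<le> i" for i
      using that
    proof (induction i rule: dec_induct)
      case (step i)
      then show ?case
      proof (elim disjE)
        assume eq: "res i = res n"
        show ?thesis
          using res_good[of i]
        proof
          assume "C (Suc i) = (\<lambda>k. 0)"
          then show ?thesis using eq by (simp add: res_Suc level_zero)
        qed (use eq in \<open>simp add: good_def res_Suc\<close>)
      qed (use res_mono[of i] in linarith)
    qed simp
    obtain i where i: "j = Suc i" "n \<le> i" using j(1) by (cases j) auto
    show ?thesis
      using dich[OF i(2)]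
    proof
      assume "res i = res n"
      then have "good (Suc i) (res i) (C (Suc i))"
        using pick[of "Suc i" "res i"] j(2) i(1) by (auto simp: C_def)
      then show ?thesis
        using \<open>res i = res n\<close> by (intro exI[of _ "Suc i"]) (simp add: good_def res_Suc)
    qed blast
  qed
  have small: "\<exists>m. Lp_norm p (res m) \<le> \<theta> ^ i * Lp_norm p f" for i
  proof (induction i)
    case 0
    show ?case by (rule exI[of _ 0]) (simp add: res)
  next
    case (Suc i)
    then obtain n where n: "Lp_norm p (res n) \<le> \<theta> ^ i * Lp_norm p f" by blast
    obtain m where "Lp_norm p (res m) \<le> \<theta> * Lp_norm p (res n)" using shrink by blast
    also have "\<dots> \<le> \<theta> * (\<theta> ^ i * Lp_norm p f)" using n \<theta> by (intro mult_left_mono)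
    finally show ?case by (auto simp: mult_ac)
  qed
  have res_lim: "(\<lambda>n. Lp_norm p (res n)) \<longlonglongrightarrow> 0"
  proof (rule LIMSEQ_I)
    fix e :: real assume e: "0 < e"
    have "(\<lambda>i. \<theta> ^ i * Lp_norm p f) \<longlonglongrightarrow> 0 * Lp_norm p f"
      using \<theta> by (intro tendsto_intros LIMSEQ_power_zero) simp
    then have "\<forall>\<^sub>F i in sequentially. \<theta> ^ i * Lp_norm p f < e"
      by (rule order_tendstoD(2)) (use e in simp)
    then obtain i where "\<theta> ^ i * Lp_norm p f < e"
      by (meson eventually_sequentially order_refl)
    then obtain m where m: "Lp_norm p (res m) < e" using small[of i] by (meson order_le_less_trans)
    show "\<exists>no. \<forall>n\<ge>no. norm (Lp_norm p (res n) - 0) < e"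
      using res_anti m by (intro exI[of _ m]) (auto intro: order_le_less_trans)
  qed
  have res_eq: "res N = (\<lambda>x. f x - (\<Sum>j\<in>{0<..N}. synthesis_level p a b \<psi> C j x))" for N
  proof (induction N)
    case (Suc N)
    have "{0<..Suc N} = insert (Suc N) {0<..N}" by auto
    then show ?case by (simp add: res_Suc Suc synthesis_level_eq fun_eq_iff)
  qed (simp add: res)
  have cost_sum: "(\<Sum>j\<in>{0<..N}. cost (C j)) \<le> \<kappa> * (Lp_norm p f - Lp_norm p (res N))" for N
  proof (induction N)
    case (Suc N)
    have "{0<..Suc N} = insert (Suc N) {0<..N}" by auto
    then show ?case using Suc C_cost[of N] by (simp add: algebra_simps)
  qed (simp add: res)
  have cost_fin: "(\<Sum>j\<in>F. cost (C j)) \<le> \<kappa> * Lp_norm p f" if "finite F" "F \<subseteq> {0<..}" for F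
  proof -
    have "F \<subseteq> {0<..Max F}" using that by auto
    then have "(\<Sum>j\<in>F. cost (C j)) \<le> (\<Sum>j\<in>{0<..Max F}. cost (C j))"
      by (intro sum_mono2) (auto simp: cost_nonneg)
    also have "\<dots> \<le> \<kappa> * Lp_norm p f"
      by (rule order_trans[OF cost_sum mult_left_mono]) (use \<kappa> in auto)
    finally show ?thesis .
  qed
  let ?K = "L powr (- (1 - 1 / p))"
  let ?q = "\<lambda>j. (\<Sum>\<^sub>\<infinity>k. norm (C j k) powr p) powr (1 / p)"
  have K: "0 < ?K" using L_pos by simp
  have costs: "(\<lambda>j. cost (C j)) summable_on {0<..}"
    by (rule nonneg_bdd_above_summable_on) (auto simp: cost_nonneg intro!: bdd_aboveI2 cost_fin)
  then have "(\<lambda>j. inverse ?K * cost (C j)) summable_on {0<..}"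
    by (rule summable_on_cmult_right)
  moreover have q: "inverse ?K * cost (C j) = ?q j" for j
    using K by (simp add: cost_def)
  ultimately have qs: "?q summable_on {0<..}" by simp
  have summ: "(\<lambda>k. norm (C j k) powr p) summable_on UNIV" for j
    using p by (intro summable_on_cong_neutral[THEN iffD1, OF _ _ _ summable_on_finite[OF C_fin[of j]]]) auto
  have CL: "C \<in> l1lp_space p"
    using qs summ by (simp add: l1lp_space_def)
  have lev_le: "Lp_norm p (level (a j) (C j)) \<le> cost (C j)" if "j > 0" for j
    by (intro level_bound a(1) that summ Lp_spaceD(1)[OF C_lev[OF that]])
  have "is_synthesis p a b \<psi> C f"
    unfolding is_synthesis_def
  proof (intro conjI allI impI f)
    fix j :: nat assume j: "0 < j"
    show "synthesis_level p a b \<psi> C j \<in> Lp_space p"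
      by (simp add: synthesis_level_eq C_lev[OF j])
    show "AE x in lebesgue. (\<lambda>k. norm (C j k * affine_system p a b \<psi> j k x)) summable_on UNIV"
      by (intro AE_I2 summable_on_cong_neutral[THEN iffD1, OF _ _ _ summable_on_finite[OF C_fin[of j]]]) auto
  next
    show "(\<lambda>j. Lp_norm p (synthesis_level p a b \<psi> C j)) summable_on {0<..}"
      unfolding synthesis_level_eq
      by (rule summable_on_comparison_test[OF costs]) (auto intro: lev_le)
    show "(\<lambda>N. Lp_norm p (\<lambda>x. f x - (\<Sum>j\<in>{0<..N}. synthesis_level p a b \<psi> C j x))) \<longlonglongrightarrow> 0"
      using res_lim unfolding res_eq .
  qed
  moreover have "?K * l1lp_norm p C \<le> \<kappa> * Lp_norm p f"
  proof -
    have "?K * l1lp_norm p C = (\<Sum>\<^sub>\<infinity>j\<in>{0<..}. cost (C j))"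
      unfolding l1lp_norm_def cost_def by (rule infsum_cmult_right'[symmetric])
    also have "\<dots> \<le> \<kappa> * Lp_norm p f"
      by (rule infsum_le_finite_sums[OF costs]) (rule cost_fin)
    finally show ?thesis .
  qed
  ultimately show ?thesis using CL that by blast
qed

lemma norm_eq_INF:
  assumes a: "\<And>j. j > 0 \<Longrightarrow> invertible (a j)" "expanding a" and f: "f \<in> Lp_space p"
  shows "ereal (Lp_norm p f) = ereal (L powr (- (1 - 1 / p))) *
    (INF c \<in> {c \<in> l1lp_space p. is_synthesis p a b \<psi> c f}. ereal (l1lp_norm p c))"
proof -
  define K where "K = L powr (- (1 - 1 / p))"
  let ?I = "INF c \<in> {c \<in> l1lp_space p. is_synthesis p a b \<psi> c f}. ereal (l1lp_norm p c)"
  let ?X = "Lp_norm p f / K"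
  have K: "0 < K" using L_pos by (simp add: K_def)
  have "?I = ereal ?X"
  proof (rule antisym)
    show "ereal ?X \<le> ?I"
    proof (rule INF_greatest)
      fix c assume "c \<in> {c \<in> l1lp_space p. is_synthesis p a b \<psi> c f}"
      then have c: "c \<in> l1lp_space p" "is_synthesis p a b \<psi> c f" by auto
      have "Lp_norm p f \<le> K * l1lp_norm p c"
        unfolding K_def by (rule synthesis_norm_ge[OF a(1) c])
      then show "ereal ?X \<le> ereal (l1lp_norm p c)"
        using K by (simp add: pos_divide_le_eq mult.commute)
    qed
    show "?I \<le> ereal ?X"
    proof (rule ereal_le_epsilon2)
      fix e :: real assume e: "0 < e"
      have X: "0 \<le> ?X" using K by simp
      \<comment> \<open>The summand 1 keeps the quotient defined when the norm is 0, and it makes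
        the excess \<open>(\<kappa> - 1) * ?X\<close> at most \<open>e\<close>.\<close>
      define \<kappa> where "\<kappa> = 1 + e / (?X + 1)"
      have k: "1 < \<kappa>" using e X by (simp add: \<kappa>_def)
      obtain C where C: "C \<in> l1lp_space p" "is_synthesis p a b \<psi> C f" "K * l1lp_norm p C \<le> \<kappa> * Lp_norm p f"
        using synthesis_exists[OF a f k] unfolding K_def by blast
      have "l1lp_norm p C \<le> \<kappa> * ?X"
        using C(3) K by (simp add: pos_le_divide_eq mult.commute)
      also have "\<dots> = ?X + e * (?X / (?X + 1))" by (simp add: \<kappa>_def algebra_simps)
      also have "\<dots> \<le> ?X + e * 1"
      proof -
        have "y / (y + 1) \<le> 1" if "0 \<le> y" for y :: real
          using that by simp
        from this[OF X] show ?thesis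
          using e by (intro add_left_mono mult_left_mono) auto
      qed
      finally have "ereal (l1lp_norm p C) \<le> ereal ?X + ereal e" by simp
      then show "?I \<le> ereal ?X + ereal e"
        using C by (intro INF_lower2[of C]) auto
    qed
  qed
  then show ?thesis unfolding K_def[symmetric] using K by simp
qed

end

section \<open>Reduction to a generator that is real and nonnegative everywhere\<close>

theorem corollary4:
  fixes a :: "nat \<Rightarrow> real ^ 'n ^ 'n" and b :: "real ^ 'n ^ 'n"
    and \<psi> f :: "real ^ 'n \<Rightarrow> complex"
    and p :: real and q :: ereal
  assumes "\<And>j. j > 0 \<Longrightarrow> invertible (a j)"
    and "expanding a"
    and "invertible b"
    and "1 \<le> p"
    and "1 \<le> q" and "1 / ereal p + 1 / q = 1"
    and "\<psi> \<in> Lp_space p"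
    and "AE x in lebesgue. \<psi> x \<in> \<real>\<^sub>\<ge>\<^sub>0"
    and "p = 1 \<Longrightarrow> (LINT x|lebesgue. \<psi> x) = 1"
    and "1 < p \<Longrightarrow> (AE x in lebesgue. periodization b \<psi> x = 1)"
    and "f \<in> Lp_space p"
  shows "ereal (Lp_norm p f) =
    ereal (\<bar>det b\<bar> powr (- real_of_ereal (1 / q))) *
      (INF c \<in> {c \<in> l1lp_space p. is_synthesis p a b \<psi> c f}. ereal (l1lp_norm p c))"
proof -
  \<comment> \<open>For \<open>p = 1\<close> the exponent \<open>q\<close> is infinite and both
    sides are 0.\<close>
  have q: "real_of_ereal (1 / q) = 1 - 1 / p"
    using assms(4-6) by (cases q) (auto simp: one_ereal_def)
  define w where "w = (\<lambda>x. max 0 (Re (\<psi> x)))"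
  have psim: "\<psi> \<in> borel_measurable lebesgue" by (rule Lp_spaceD(1)[OF assms(7)])
  have wm: "w \<in> borel_measurable lebesgue" unfolding w_def using psim by measurable
  have w0: "0 \<le> w x" for x by (simp add: w_def)
  have psi_w: "AE x in lebesgue. \<psi> x = of_real (w x)"
    using assms(8) by (rule eventually_mono) (auto simp: w_def nonneg_Reals_def)
  have psi_tr: "AE x in lebesgue. \<forall>k. \<psi> (x - b *v lattice_vec k) = of_real (w (x - b *v lattice_vec k))"
    unfolding AE_all_countable
    using AE_affine[OF invertible_mat1 psi_w, of "- (b *v lattice_vec k)" for k] by simp
  have per: "AE x in lebesgue. (\<lambda>k. w (x - b *v lattice_vec k)) summable_on UNIV \<and>
      \<bar>det b\<bar> * (\<Sum>\<^sub>\<infinity>k. w (x - b *v lattice_vec k)) = 1" if "1 < p"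
    using assms(10)[OF that] psi_tr
  proof eventually_elim
    case (elim x)
    let ?g = "\<lambda>k. \<psi> (x - b *v lattice_vec k)"
    have eq: "of_real \<bar>det b\<bar> * (\<Sum>\<^sub>\<infinity>k. ?g k) = 1" using elim(1) by (simp add: periodization_def)
    \<comment> \<open>A divergent sum would have the default value 0, and the periodization could
      not be 1.\<close>
    then have "?g summable_on UNIV" using infsum_not_exists by fastforce
    then have "(?g has_sum (\<Sum>\<^sub>\<infinity>k. ?g k)) UNIV" by (rule has_sum_infsum)
    then have "((\<lambda>k. Re (?g k)) has_sum Re (\<Sum>\<^sub>\<infinity>k. ?g k)) UNIV"
      using has_sum_bounded_linear[OF bounded_linear_Re] by blast
    then have hs: "((\<lambda>k. w (x - b *v lattice_vec k)) has_sum Re (\<Sum>\<^sub>\<infinity>k. ?g k)) UNIV"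
      using elim(2) by simp
    have "\<bar>det b\<bar> * Re (\<Sum>\<^sub>\<infinity>k. ?g k) = 1"
      using arg_cong[OF eq, of Re] by simp
    then show ?case
      using hs infsumI[OF hs] has_sum_imp_summable by auto
  qed
  have w_int: "integrable lebesgue w \<and> (LINT x|lebesgue. w x) = 1"
  proof (cases "p = 1")
    case True
    have "integrable lebesgue (\<lambda>x. norm (\<psi> x))"
      using Lp_spaceD(2)[OF assms(7)] True by simp
    then have i: "integrable lebesgue w"
      by (rule Bochner_Integration.integrable_bound[OF _ wm])
        (auto intro!: AE_I2 simp: w_def abs_Re_le_cmod order_trans[OF complex_Re_le_cmod])
    have "(LINT x|lebesgue. \<psi> x) = (LINT x|lebesgue. complex_of_real (w x))"
      using psim wm psi_w by (intro integral_cong_AE) auto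
    then have "complex_of_real (LINT x|lebesgue. w x) = 1"
      using assms(9)[OF True] by simp
    then show ?thesis using i by (simp only: of_real_eq_1_iff)
  next
    case False
    then have "1 < p" using assms(4) by simp
    then show ?thesis using integral_of_periodization[OF assms(3) wm w0 per] by blast
  qed
  interpret affine_synthesis p b \<psi> w
  proof
    show "p = 1 \<or> (AE x in lebesgue. \<forall>F. finite F \<longrightarrow>
        \<bar>det b\<bar> * (\<Sum>k\<in>F. w (x - b *v lattice_vec k)) \<le> 1)"
    proof (cases "p = 1")
      case False
      then have "1 < p" using assms(4) by simp
      have "AE x in lebesgue. \<forall>F. finite F \<longrightarrow> \<bar>det b\<bar> * (\<Sum>k\<in>F. w (x - b *v lattice_vec k)) \<le> 1"
        using per[OF \<open>1 < p\<close>]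
      proof (rule eventually_mono, intro allI impI)
        fix x and F :: "(int ^ 'n) set"
        assume x: "(\<lambda>k. w (x - b *v lattice_vec k)) summable_on UNIV \<and>
          \<bar>det b\<bar> * (\<Sum>\<^sub>\<infinity>k. w (x - b *v lattice_vec k)) = 1" and F: "finite F"
        have "(\<Sum>k\<in>F. w (x - b *v lattice_vec k)) \<le> (\<Sum>\<^sub>\<infinity>k. w (x - b *v lattice_vec k))"
          using x F w0 by (intro finite_sum_le_infsum) auto
        then show "\<bar>det b\<bar> * (\<Sum>k\<in>F. w (x - b *v lattice_vec k)) \<le> 1"
          using x mult_left_mono[of _ _ "\<bar>det b\<bar>"] by fastforce
      qed
      then show ?thesis ..
    qed simp
  qed (use assms psi_w w0 w_int in auto)
  show ?thesis
    unfolding q by (rule norm_eq_INF[OF assms(1,2,11)])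
qed

end
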